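(* Let $B$ be a surface braid in $\mathbb{C}\times S^1\times S^1$ of degree $m$ and without any branch points. Then there exists a holomorphic polynomial $f:\mathbb{C}^3\to\mathbb{C}$ such that $f^{-1}(0)\cap(\mathbb{C}\times S^1\times S^1)$ is equivalent to $B$ and $\deg_u f=m$, where $\deg_u f$ is the polynomial degree of $f$ with respect to the first complex variable $u$.
   Context: Here $S^1\subset\mathbb{C}$ is the unit circle, so $\mathbb{C}\times S^1\times S^1\subset\mathbb{C}^3$. A surface braid of degree $m$ in $\mathbb{C}\times S^1\times S^1$ is a compact oriented surface $B\subset\mathbb{C}\times S^1\times S^1$ such that the restriction to $B$ of the projection $p:\mathbb{C}\times S^1\times S^1\to S^1\times S^1$ is an oriented simple branched covering map of degree $m$ (there is no boundary condition because the torus $S^1\times S^1$ has no boundary). It is without branch points if $p|_B$ is an (unbranched) covering map. Two surface braids are equivalent if they are related by a fiber-preserving isotopy of $\mathbb{C}\times S^1\times S^1$ (with respect to the fibration $p$). A holomorphic polynomial $\mathbb{C}^3\to\mathbb{C}$ is an element of $\mathbb{C}[u,v,w]$ regarded as a function. *)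

theory Defs
  imports "HOL-Complex_Analysis.Complex_Analysis" "HOL-Computational_Algebra.Polynomial"
begin

text \<open>
  Surfaces are topological 2-manifolds. A chart is a pair of its (relatively open) domain and a
  coordinate function, which is relevant on that domain only. An orientation is given by an
  atlas with orientation-preserving transition maps; it need not be maximal.
\<close>

type_synonym 'a chart = "'a set \<times> ('a \<Rightarrow> complex)"

definition is_chart :: "'a::topological_space set \<Rightarrow> 'a chart \<Rightarrow> bool" where
  "is_chart S = (\<lambda>(U, \<phi>). openin (top_of_set S) U \<and> open (\<phi> ` U) \<and>
     (\<exists>\<phi>'. homeomorphism U (\<phi> ` U) \<phi> \<phi>'))"

text \<open>
  Used for topological embeddings of open plane sets only, for which the winding numbers below
  can only be \<open>1\<close> or \<open>-1\<close>, i.e. they are the local degrees.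
\<close>

definition orientation_preserving_on :: "complex set \<Rightarrow> (complex \<Rightarrow> complex) \<Rightarrow> bool" where
  "orientation_preserving_on U f \<longleftrightarrow>
     (\<forall>z r. 0 < r \<and> cball z r \<subseteq> U \<longrightarrow> winding_number (f \<circ> circlepath z r) (f z) = 1)"

definition orientedly_compatible :: "'a chart \<Rightarrow> 'a chart \<Rightarrow> bool" where
  "orientedly_compatible = (\<lambda>(U, \<phi>) (V, \<psi>).
     orientation_preserving_on (\<phi> ` (U \<inter> V)) (\<psi> \<circ> inv_into U \<phi>))"

definition oriented_surface :: "'a::topological_space set \<Rightarrow> 'a chart set \<Rightarrow> bool" where
  "oriented_surface S \<A> \<longleftrightarrow>
     (\<forall>c\<in>\<A>. is_chart S c) \<and> (\<Union>c\<in>\<A>. fst c) = S \<and>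
     (\<forall>c\<in>\<A>. \<forall>d\<in>\<A>. orientedly_compatible c d)"

definition oriented_chart ::
  "'a::topological_space set \<Rightarrow> 'a chart set \<Rightarrow> 'a chart \<Rightarrow> bool" where
  "oriented_chart S \<A> c \<longleftrightarrow>
     is_chart S c \<and> (\<forall>d\<in>\<A>. orientedly_compatible c d \<and> orientedly_compatible d c)"

text \<open>In suitable oriented charts centred at \<open>x\<close> and \<open>p x\<close>, the map \<open>p\<close> is \<open>z \<mapsto> z ^ k\<close>.\<close>

definition local_power_map ::
  "'a::topological_space set \<Rightarrow> 'a chart set \<Rightarrow> 'b::topological_space set \<Rightarrow> 'b chart set \<Rightarrow>
   ('a \<Rightarrow> 'b) \<Rightarrow> 'a \<Rightarrow> nat \<Rightarrow> bool" where
  "local_power_map S \<A> T \<B> p x k \<longleftrightarrow>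
     (\<exists>U \<phi> V \<psi>. oriented_chart S \<A> (U, \<phi>) \<and> oriented_chart T \<B> (V, \<psi>) \<and>
        x \<in> U \<and> p ` U \<subseteq> V \<and> \<phi> x = 0 \<and> \<psi> (p x) = 0 \<and>
        (\<forall>y\<in>U. \<psi> (p y) = \<phi> y ^ k))"

definition branch_points ::
  "'a::topological_space set \<Rightarrow> 'a chart set \<Rightarrow> 'b::topological_space set \<Rightarrow> 'b chart set \<Rightarrow>
   ('a \<Rightarrow> 'b) \<Rightarrow> 'a set" where
  "branch_points S \<A> T \<B> p = {x \<in> S. \<exists>k\<ge>2. local_power_map S \<A> T \<B> p x k}"

definition oriented_branched_covering ::
  "nat \<Rightarrow> 'a::topological_space set \<Rightarrow> 'a chart set \<Rightarrow> 'b::topological_space set \<Rightarrow>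
   'b chart set \<Rightarrow> ('a \<Rightarrow> 'b) \<Rightarrow> bool" where
  "oriented_branched_covering m S \<A> T \<B> p \<longleftrightarrow>
     continuous_on S p \<and> p ` S = T \<and>
     (\<forall>x\<in>S. \<exists>k\<ge>1. local_power_map S \<A> T \<B> p x k) \<and>
     (\<forall>y\<in>T. finite {x \<in> S. p x = y}) \<and>
     (let \<Delta> = p ` branch_points S \<A> T \<B> p in
        finite \<Delta> \<and> covering_space {x \<in> S. p x \<notin> \<Delta>} p (T - \<Delta>) \<and>
        (\<forall>y\<in>T - \<Delta>. card {x \<in> S. p x = y} = m))"

text \<open>
  In a simple branched covering, each fibre over a branch value contains exactly one branch
  point, and that branch point has index two; equivalently, such a fibre has \<open>m - 1\<close> points.
\<close>

definition oriented_simple_branched_covering ::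
  "nat \<Rightarrow> 'a::topological_space set \<Rightarrow> 'a chart set \<Rightarrow> 'b::topological_space set \<Rightarrow>
   'b chart set \<Rightarrow> ('a \<Rightarrow> 'b) \<Rightarrow> bool" where
  "oriented_simple_branched_covering m S \<A> T \<B> p \<longleftrightarrow>
     oriented_branched_covering m S \<A> T \<B> p \<and>
     (\<forall>y \<in> p ` branch_points S \<A> T \<B> p. card {x \<in> S. p x = y} = m - 1)"

definition torus :: "(complex \<times> complex) set" where
  "torus = sphere 0 1 \<times> sphere 0 1"

text \<open>
  The product orientation of the torus: its charts are the local inverses of the universal
  covering \<open>s + \<i> t \<mapsto> (cis s, cis t)\<close>.
\<close>

definition torus_atlas :: "(complex \<times> complex) chart set" where
  "torus_atlas = {(V, \<psi>). is_chart torus (V, \<psi>) \<and>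
     (\<forall>q\<in>V. q = (cis (Re (\<psi> q)), cis (Im (\<psi> q))))}"

text \<open>With coordinates \<open>(u, v, w)\<close>, the projection to \<open>(v, w)\<close> is \<^const>\<open>snd\<close>.\<close>

type_synonym point = "complex \<times> complex \<times> complex"

definition braid_space :: "point set" where
  "braid_space = UNIV \<times> torus"

definition surface_braid :: "nat \<Rightarrow> point set \<Rightarrow> point chart set \<Rightarrow> bool" where
  "surface_braid m B \<A> \<longleftrightarrow>
     B \<subseteq> braid_space \<and> compact B \<and> oriented_surface B \<A> \<and>
     oriented_simple_branched_covering m B \<A> torus torus_atlas snd"

definition without_branch_points :: "point set \<Rightarrow> bool" where
  "without_branch_points B \<longleftrightarrow> covering_space B snd torus"

text \<open>
  Fibre-preserving means that each stage maps fibres onto fibres, so it covers a homeomorphism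
  of the base, which need not be the identity.
\<close>

definition fibre_preserving_isotopy :: "(real \<Rightarrow> point \<Rightarrow> point) \<Rightarrow> bool" where
  "fibre_preserving_isotopy h \<longleftrightarrow>
     continuous_on ({0..1} \<times> braid_space) (\<lambda>(t, x). h t x) \<and>
     (\<forall>x\<in>braid_space. h 0 x = x) \<and>
     (\<forall>t\<in>{0..1}.
        (\<exists>h'. homeomorphism braid_space braid_space (h t) h') \<and>
        (\<exists>g g'. homeomorphism torus torus g g' \<and>
           (\<forall>x\<in>braid_space. snd (h t x) = g (snd x))))"

text \<open>The last conjunct says that \<open>h 1\<close> carries the orientation of \<open>B\<close> to that of \<open>B'\<close>.\<close>

definition equivalent_surface_braids ::
  "point set \<Rightarrow> point chart set \<Rightarrow> point set \<Rightarrow> point chart set \<Rightarrow> bool" where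
  "equivalent_surface_braids B \<A> B' \<A>' \<longleftrightarrow>
     (\<exists>h. fibre_preserving_isotopy h \<and> h 1 ` B = B' \<and>
        (\<forall>(U, \<phi>)\<in>\<A>. oriented_chart B' \<A>' (h 1 ` U, \<phi> \<circ> inv_into braid_space (h 1))))"

text \<open>
  \<open>\<complex>[u,v,w]\<close> is rendered as \<open>\<complex>[w][v][u]\<close>: the outermost variable is \<open>u\<close>, so the degree with
  respect to \<open>u\<close> is \<^const>\<open>degree\<close>.
\<close>

definition eval_uvw :: "complex poly poly poly \<Rightarrow> point \<Rightarrow> complex" where
  "eval_uvw f = (\<lambda>(u, v, w). poly (poly (poly f [:[:u:]:]) [:v:]) w)"

definition zero_set_in_braid_space :: "complex poly poly poly \<Rightarrow> point set" where
  "zero_set_in_braid_space f = eval_uvw f -` {0} \<inter> braid_space"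

end

theory Submission
  imports Defs "HOL-Computational_Algebra.Fundamental_Theorem_Algebra"
begin

text \<open>
  Write \<open>r\<^sub>1(q), \<dots>, r\<^sub>m(q)\<close> for the points of \<open>B\<close> over a point \<open>q = (v, w)\<close> of the torus.
  Individually they are continuous only locally, but the coefficients of the monic polynomial
  \<open>R\<^sub>q(u) = \<Prod>\<^sub>i (u - r\<^sub>i(q))\<close> are symmetric in them and therefore continuous on the whole torus
  (\<open>continuous_on_coeff_fibre_poly\<close>), and \<open>B\<close> is the zero set of \<open>R\<^sub>q(u)\<close>. By the
  Stone-Weierstrass theorem these coefficients are uniformly approximated by polynomials in the
  real and imaginary parts of \<open>v\<close> and \<open>w\<close>. On the torus the conjugates of \<open>v\<close> and \<open>w\<close> are
  their inverses, so that the approximations are Laurent polynomials in \<open>v\<close> and \<open>w\<close>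
  (\<open>laurent_approximation_on_torus\<close>). Multiplication by a high power of the unit \<open>v w\<close> clears the
  denominators without changing the zeros, and yields a polynomial \<open>f\<close> in \<open>u, v, w\<close> of
  \<open>u\<close>-degree \<open>m\<close> (\<open>polynomial_with_laurent_coefficients\<close>).

  It remains to see that a good enough approximation gives an equivalent surface. The points of a fibre
  have a uniform distance \<open>\<epsilon>\<close> from each other, because \<open>B\<close> is compact and the projection is
  locally injective. If \<open>P\<^sub>q\<close> is a monic polynomial of degree \<open>m\<close> close to \<open>R\<^sub>q\<close>, then
  \<open>P\<^sub>q\<close> is small at each root of \<open>R\<^sub>q\<close>, and since \<open>P\<^sub>q\<close> is a product of \<open>m\<close> linear
  factors, one of them must be small there. So there is a root of \<open>P\<^sub>q\<close> near each root of
  \<open>R\<^sub>q\<close>, and by the separation and by counting there is exactly one and there are no others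
  (\<open>roots_near_separated_almost_roots\<close>). The roots of \<open>P\<^sub>q\<close> thus form a surface that is
  obtained from \<open>B\<close> by a small displacement along the fibres. Extending the inverse displacement by
  cut-off functions to a vector field on the fibres with a small Lipschitz constant gives the
  ambient isotopy (\<open>isotopy_to_close_surface\<close>). Its final stage covers the identity of the torus,
  and so it carries the atlas and the covering structure of \<open>B\<close> back to the zero set of \<open>f\<close>
  (\<open>surface_braid_via_isotopy\<close>).
\<close>

section \<open>Transport of surface braids along homeomorphisms\<close>

lemma orientation_preserving_on_cong:
  assumes "\<And>x. x \<in> U \<Longrightarrow> f x = g x"
  shows "orientation_preserving_on U f \<longleftrightarrow> orientation_preserving_on U g"
proof -
  have "f \<circ> circlepath z r = g \<circ> circlepath z r \<and> f z = g z" if "0 < r" "cball z r \<subseteq> U" for z r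
  proof -
    have "circlepath z r x \<in> U" for x
      using that by (auto simp: circlepath dist_norm norm_mult)
    moreover have "z \<in> U"
      using that by auto
    ultimately show ?thesis
      by (auto simp: assms fun_eq_iff)
  qed
  then show ?thesis
    unfolding orientation_preserving_on_def by metis
qed

text \<open>
  The transition map between two charts is determined by the values of the charts on their domains and
  is the same for the transported charts. With \<open>H\<close> the identity this says that values of a chart
  outside its domain do not matter.
\<close>

lemma orientedly_compatible_transport:
  assumes H: "bij_betw H S' S" and "U \<subseteq> S" "V \<subseteq> S" and inj: "inj_on \<phi> U"
    and \<phi>': "\<And>x. x \<in> S' \<inter> H -` U \<Longrightarrow> \<phi>' x = \<phi> (H x)"
    and \<psi>': "\<And>x. x \<in> S' \<inter> H -` V \<Longrightarrow> \<psi>' x = \<psi> (H x)"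
  shows "orientedly_compatible (S' \<inter> H -` U, \<phi>') (S' \<inter> H -` V, \<psi>') \<longleftrightarrow>
         orientedly_compatible (U, \<phi>) (V, \<psi>)"
proof -
  let ?U = "S' \<inter> H -` U" and ?V = "S' \<inter> H -` V"
  have HUV: "H ` (?U \<inter> ?V) = U \<inter> V"
    using H assms(2,3) by (auto simp: bij_betw_def)
  have inj': "inj_on \<phi>' ?U"
    using inj H by (auto simp: inj_on_def bij_betw_def \<phi>')
  have dom: "\<phi>' ` (?U \<inter> ?V) = \<phi> ` (U \<inter> V)"
    unfolding HUV[symmetric] image_image by (rule image_cong) (auto simp: \<phi>')
  have "(\<psi>' \<circ> inv_into ?U \<phi>') z = (\<psi> \<circ> inv_into U \<phi>) z" if z: "z \<in> \<phi> ` (U \<inter> V)" for z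
  proof -
    obtain x where x: "x \<in> ?U" "x \<in> ?V" "z = \<phi>' x"
      using z unfolding dom[symmetric] by (elim imageE IntE) simp
    have "inv_into ?U \<phi>' z = x"
      using x inj' by (simp only: inv_into_f_f)
    moreover have "inv_into U \<phi> z = H x"
      using x inj by (auto simp: \<phi>')
    ultimately show ?thesis
      using x by (simp add: \<psi>')
  qed
  then show ?thesis
    unfolding orientedly_compatible_def prod.case dom by (rule orientation_preserving_on_cong)
qed

lemma is_chart_inj: "is_chart S (U, \<phi>) \<Longrightarrow> inj_on \<phi> U"
  by (auto simp: is_chart_def homeomorphism_def intro: inj_on_inverseI)

lemma is_chart_openin: "is_chart S (U, \<phi>) \<Longrightarrow> openin (top_of_set S) U"
  by (auto simp: is_chart_def)

lemma is_chart_subset: "is_chart S (U, \<phi>) \<Longrightarrow> U \<subseteq> S"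
  by (auto dest: is_chart_openin openin_imp_subset)

text \<open>
  The new coordinate function is fixed on its domain only, so that the case of \<open>H\<close> the identity
  replaces a coordinate function by one that agrees with it on the domain.
\<close>

lemma is_chart_transport:
  assumes H: "homeomorphism S' S H G" and c: "is_chart S (U, \<phi>)"
    and \<phi>': "\<And>x. x \<in> S' \<inter> H -` U \<Longrightarrow> \<phi>' x = \<phi> (H x)"
  shows "is_chart S' (S' \<inter> H -` U, \<phi>')"
proof -
  let ?U = "S' \<inter> H -` U"
  from c obtain k where U: "openin (top_of_set S) U" "open (\<phi> ` U)"
    and k: "homeomorphism U (\<phi> ` U) \<phi> k"
    by (auto simp: is_chart_def)
  have "openin (top_of_set S') ?U"
    using H U(1) by (metis continuous_on_open homeomorphism_cont1 homeomorphism_image1)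
  moreover have HU: "H ` ?U = U"
    using H openin_imp_subset[OF U(1)] by (auto simp: homeomorphism_def)
  then have "homeomorphism ?U U H G"
    using H openin_imp_subset[OF U(1)] by (intro homeomorphism_of_subsets[OF H]) auto
  from homeomorphism_compose[OF this k]
  have hom: "homeomorphism ?U (\<phi> ` U) \<phi>' (G \<circ> k)"
    by (rule homeomorphism_cong) (auto simp: \<phi>')
  moreover have "\<phi>' ` ?U = \<phi> ` U"
    using hom by (simp add: homeomorphism_def)
  ultimately show ?thesis
    unfolding is_chart_def prod.case using U(2) by metis
qed

definition pullback_chart :: "'a set \<Rightarrow> ('a \<Rightarrow> 'b) \<Rightarrow> 'b chart \<Rightarrow> 'a chart" where
  "pullback_chart S' H = (\<lambda>(U, \<phi>). (S' \<inter> H -` U, \<phi> \<circ> H))"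

lemma is_chart_pullback:
  "\<lbrakk>homeomorphism S' S H G; is_chart S c\<rbrakk> \<Longrightarrow> is_chart S' (pullback_chart S' H c)"
  by (cases c) (auto simp: pullback_chart_def intro: is_chart_transport)

lemma orientedly_compatible_pullback:
  assumes H: "homeomorphism S' S H G" and c: "is_chart S c" and d: "is_chart S d"
    and "orientedly_compatible c d"
  shows "orientedly_compatible (pullback_chart S' H c) (pullback_chart S' H d)"
proof -
  have "bij_betw H S' S"
    using H by (auto simp: homeomorphism_def bij_betw_def intro: inj_on_inverseI)
  moreover obtain U \<phi> V \<psi> where cd: "c = (U, \<phi>)" "d = (V, \<psi>)"
    by (metis surj_pair)
  ultimately show ?thesis
    using assms(4) orientedly_compatible_transport[of H S' S U V \<phi> "\<phi> \<circ> H" "\<psi> \<circ> H" \<psi>]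
      is_chart_inj[OF c[unfolded cd]] is_chart_subset[OF c[unfolded cd]]
      is_chart_subset[OF d[unfolded cd]]
    by (simp add: pullback_chart_def cd)
qed

lemma oriented_surface_pullback:
  assumes H: "homeomorphism S' S H G" and S: "oriented_surface S \<A>"
  shows "oriented_surface S' (pullback_chart S' H ` \<A>)"
proof -
  have "(\<Union>c\<in>\<A>. fst (pullback_chart S' H c)) = S' \<inter> H -` (\<Union>c\<in>\<A>. fst c)"
    by (auto simp: pullback_chart_def split_beta)
  also have "\<dots> = S'"
    using S H by (auto simp: oriented_surface_def homeomorphism_def)
  finally show ?thesis
    using S is_chart_pullback[OF H] orientedly_compatible_pullback[OF H]
    unfolding oriented_surface_def by simp
qed

lemma oriented_chart_pullback:
  assumes H: "homeomorphism S' S H G" and S: "oriented_surface S \<A>" and c: "oriented_chart S \<A> c"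
  shows "oriented_chart S' (pullback_chart S' H ` \<A>) (pullback_chart S' H c)"
proof -
  have "is_chart S c" and d: "is_chart S d \<and> orientedly_compatible c d \<and> orientedly_compatible d c"
    if "d \<in> \<A>" for d
    using S c that unfolding oriented_surface_def oriented_chart_def by blast+
  then have "orientedly_compatible (pullback_chart S' H c) (pullback_chart S' H d)
      \<and> orientedly_compatible (pullback_chart S' H d) (pullback_chart S' H c)" if "d \<in> \<A>" for d
    using orientedly_compatible_pullback[OF H] that by blast
  moreover have "is_chart S' (pullback_chart S' H c)"
    using c is_chart_pullback[OF H] unfolding oriented_chart_def by blast
  ultimately show ?thesis
    unfolding oriented_chart_def by blast
qed

text \<open>
  Pulling a chart back and pushing it forward again gives the original chart on its domain, but in
  general another total function.
\<close>

lemma oriented_chart_cong: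
  assumes S: "oriented_surface S \<A>" and c: "oriented_chart S \<A> (U, \<phi>)"
    and \<phi>': "\<And>x. x \<in> U \<Longrightarrow> \<phi>' x = \<phi> x"
  shows "oriented_chart S \<A> (U, \<phi>')"
proof -
  have chart: "is_chart S (U, \<phi>)" and US: "U \<subseteq> S"
    using c is_chart_subset[of S U \<phi>] by (auto simp: oriented_chart_def)
  have "is_chart S (U, \<phi>')"
    using is_chart_transport[OF homeomorphism_ident chart, of \<phi>'] \<phi>' US
    by (simp add: vimage_def Int_absorb1)
  moreover have "orientedly_compatible (U, \<phi>') (V, \<psi>) \<and> orientedly_compatible (V, \<psi>) (U, \<phi>')"
    if V: "(V, \<psi>) \<in> \<A>" for V \<psi>
  proof -
    have d: "is_chart S (V, \<psi>)"
      using S V by (auto simp: oriented_surface_def)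
    note transport = orientedly_compatible_transport[of "\<lambda>x. x" S S, simplified]
    have "orientedly_compatible (U, \<phi>') (V, \<psi>) \<longleftrightarrow> orientedly_compatible (U, \<phi>) (V, \<psi>)"
      using transport[of U V \<phi> \<phi>' \<psi> \<psi>] US is_chart_subset[OF d] is_chart_inj[OF chart] \<phi>'
      by (simp add: vimage_def Int_absorb1 bij_betw_def)
    moreover have "orientedly_compatible (V, \<psi>) (U, \<phi>') \<longleftrightarrow> orientedly_compatible (V, \<psi>) (U, \<phi>)"
      using transport[of V U \<psi> \<psi> \<phi>' \<phi>] US is_chart_subset[OF d] is_chart_inj[OF d] \<phi>'
      by (simp add: vimage_def Int_absorb1 bij_betw_def)
    ultimately show ?thesis
      using c V by (auto simp: oriented_chart_def)
  qed
  ultimately show ?thesis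
    by (auto simp: oriented_chart_def)
qed

lemma local_power_map_pullback:
  assumes H: "homeomorphism S' S H G" and S: "oriented_surface S \<A>" and x: "x \<in> S'"
    and p: "\<And>y. y \<in> S' \<Longrightarrow> p' y = p (H y)" and loc: "local_power_map S \<A> T \<B> p (H x) k"
  shows "local_power_map S' (pullback_chart S' H ` \<A>) T \<B> p' x k"
proof -
  obtain U \<phi> V \<psi> where c: "oriented_chart S \<A> (U, \<phi>)" "oriented_chart T \<B> (V, \<psi>)"
    "H x \<in> U" "p ` U \<subseteq> V" "\<phi> (H x) = 0" "\<psi> (p (H x)) = 0" "\<forall>y\<in>U. \<psi> (p y) = \<phi> y ^ k"
    using loc unfolding local_power_map_def by blast
  have c': "oriented_chart S' (pullback_chart S' H ` \<A>) (S' \<inter> H -` U, \<phi> \<circ> H)"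
    using oriented_chart_pullback[OF H S c(1)] by (simp add: pullback_chart_def)
  show ?thesis
    unfolding local_power_map_def
  proof (intro exI conjI)
    show "oriented_chart S' (pullback_chart S' H ` \<A>) (S' \<inter> H -` U, \<phi> \<circ> H)" by (rule c')
    show "oriented_chart T \<B> (V, \<psi>)" by (rule c(2))
    show "p' ` (S' \<inter> H -` U) \<subseteq> V"
    proof (rule image_subsetI)
      fix y assume "y \<in> S' \<inter> H -` U"
      then show "p' y \<in> V" using c(4) by (auto simp: p)
    qed
    show "\<forall>y\<in>S' \<inter> H -` U. \<psi> (p' y) = (\<phi> \<circ> H) y ^ k"
      using c(7) p by simp
  qed (use c x p in auto)
qed

text \<open>
  A covering map is locally injective, whereas \<open>z \<mapsto> z ^ k\<close> with \<open>k \<ge> 2\<close> identifies a small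
  \<open>z\<close> with its multiple by a \<open>k\<close>-th root of unity.
\<close>

lemma covering_space_no_branch_points:
  assumes cov: "covering_space S p T"
  shows "branch_points S \<A> T \<B> p = {}"
proof (rule ccontr)
  assume "branch_points S \<A> T \<B> p \<noteq> {}"
  then obtain x k where x: "x \<in> S" and k: "2 \<le> k" and loc: "local_power_map S \<A> T \<B> p x k"
    by (auto simp: branch_points_def)
  obtain U \<phi> V \<psi> where c: "oriented_chart S \<A> (U, \<phi>)" "oriented_chart T \<B> (V, \<psi>)"
    "x \<in> U" "p ` U \<subseteq> V" "\<phi> x = 0" "\<forall>y\<in>U. \<psi> (p y) = \<phi> y ^ k"
    using loc unfolding local_power_map_def by blast
  obtain W u q where W: "x \<in> W" "openin (top_of_set S) W" "homeomorphism W u p q"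
    using covering_space_local_homeomorphism[OF cov x] by metis
  have chart: "is_chart S (U, \<phi>)" and injV: "inj_on \<psi> V"
    using c is_chart_inj[of T V \<psi>] by (auto simp: oriented_chart_def)
  have injW: "inj_on p W"
    using W(3) by (auto simp: homeomorphism_def intro: inj_on_inverseI)
  obtain g where opU: "open (\<phi> ` U)" and g: "homeomorphism U (\<phi> ` U) \<phi> g"
    using chart by (auto simp: is_chart_def)
  have "openin (top_of_set U) (U \<inter> W)"
    using W(2) is_chart_openin[OF chart] openin_subset_trans[of S "U \<inter> W" U] is_chart_subset[OF chart]
    by (meson Int_lower1 openin_Int)
  then have "open (\<phi> ` (U \<inter> W))"
    using homeomorphism_imp_open_map[OF g] opU openin_open_eq by blast
  moreover have "0 \<in> \<phi> ` (U \<inter> W)"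
    using c(3,5) W(1) by force
  ultimately obtain e where e: "0 < e" "cball 0 e \<subseteq> \<phi> ` (U \<inter> W)"
    by (meson open_contains_cball)
  define \<zeta> where "\<zeta> = cis (2 * pi / k)"
  have \<zeta>: "\<zeta> ^ k = 1" "\<zeta> \<noteq> 1" "norm \<zeta> = 1"
  proof -
    show "\<zeta> ^ k = 1" using k unfolding \<zeta>_def Complex.DeMoivre by simp
    show "norm \<zeta> = 1" by (simp add: \<zeta>_def)
    have "cos (2 * pi / k) < cos 0"
      by (rule cos_monotone_0_pi) (use k in \<open>auto simp: field_simps\<close>)
    then show "\<zeta> \<noteq> 1"
      by (auto simp: \<zeta>_def complex_eq_iff)
  qed
  have "complex_of_real e \<in> cball 0 e" "e * \<zeta> \<in> cball 0 e"
    using \<zeta>(3) e(1) by (auto simp: norm_mult)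
  then have "complex_of_real e \<in> \<phi> ` (U \<inter> W)" "e * \<zeta> \<in> \<phi> ` (U \<inter> W)"
    using e(2) by auto
  then obtain y z where y: "y \<in> U" "y \<in> W" "\<phi> y = e" and z: "z \<in> U" "z \<in> W" "\<phi> z = e * \<zeta>"
    by (elim imageE IntE) simp
  have "\<psi> (p y) = \<psi> (p z)"
    using c(6) y z \<zeta>(1) by (simp add: power_mult_distrib)
  then have "p y = p z"
    using c(4) y(1) z(1) by (intro inj_onD[OF injV]) auto
  then have "y = z"
    using y(2) z(2) by (rule inj_onD[OF injW])
  then show False
    using y z \<zeta>(2) e(1) by auto
qed

lemma covering_space_pullback:
  assumes H: "homeomorphism S' S H G" and cov: "covering_space S p T"
    and p: "\<And>y. y \<in> S' \<Longrightarrow> p' y = p (H y)"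
  shows "covering_space S' p' T"
proof (rule covering_spaceI)
  have HS: "H ` S' = S" and contH: "continuous_on S' H"
    using H by (auto simp: homeomorphism_def)
  have "continuous_on S' (p \<circ> H)"
    using covering_space_imp_continuous[OF cov] contH HS by (metis continuous_on_compose)
  then show "continuous_on S' p'"
    by (rule continuous_on_eq) (simp add: p)
  show "p' ` S' = T"
    using covering_space_imp_surjective[OF cov] HS p by (auto simp: image_iff)
next
  fix x assume "x \<in> T"
  then obtain N \<V> where N: "x \<in> N" "openin (top_of_set T) N" and \<V>: "\<Union>\<V> = S \<inter> p -` N"
    "\<And>u. u \<in> \<V> \<Longrightarrow> openin (top_of_set S) u" "pairwise disjnt \<V>"
    "\<And>u. u \<in> \<V> \<Longrightarrow> \<exists>q. homeomorphism u N p q"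
    using cov unfolding covering_space_def by metis
  let ?f = "\<lambda>u. S' \<inter> H -` u"
  have "\<Union>(?f ` \<V>) = S' \<inter> p' -` N"
  proof -
    have "\<Union>(?f ` \<V>) = S' \<inter> H -` \<Union>\<V>" by auto
    also have "\<dots> = S' \<inter> p' -` N"
      unfolding \<V>(1) using H p by (auto simp: homeomorphism_def)
    finally show ?thesis .
  qed
  moreover have "openin (top_of_set S') (?f u)" if "u \<in> \<V>" for u
    using H \<V>(2)[OF that] by (metis continuous_on_open homeomorphism_cont1 homeomorphism_image1)
  moreover have "pairwise disjnt (?f ` \<V>)"
    using \<V>(3) by (fastforce simp: pairwise_def disjnt_def)
  moreover have "\<exists>q. homeomorphism (?f u) N p' q" if u: "u \<in> \<V>" for u
  proof -
    obtain q where q: "homeomorphism u N p q" using \<V>(4)[OF u] by blast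
    have "u \<subseteq> S" using \<V>(2)[OF u] openin_imp_subset by blast
    then have "homeomorphism (?f u) u H G"
      using H by (intro homeomorphism_of_subsets[OF H]) (auto simp: homeomorphism_def)
    from homeomorphism_compose[OF this q] have "homeomorphism (?f u) N p' (G \<circ> q)"
      by (rule homeomorphism_cong) (auto simp: p)
    then show ?thesis by blast
  qed
  ultimately show "\<exists>N. x \<in> N \<and> openin (top_of_set T) N \<and> (\<exists>v. \<Union>v = S' \<inter> p' -` N \<and>
      (\<forall>u\<in>v. openin (top_of_set S') u) \<and> pairwise disjnt v \<and> (\<forall>u\<in>v. \<exists>q. homeomorphism u N p' q))"
    using N by (intro exI[of _ N] conjI exI[of _ "?f ` \<V>"]) auto
qed

text \<open>
  The set of branch points is empty, so every fibre counts as a regular one; in particular all fibres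
  have \<open>m\<close> points.
\<close>

lemma unbranched_surface_braid_iff:
  assumes "without_branch_points B"
  shows "surface_braid m B \<A> \<longleftrightarrow>
     B \<subseteq> braid_space \<and> compact B \<and> oriented_surface B \<A> \<and>
     (\<forall>x\<in>B. \<exists>k\<ge>1. local_power_map B \<A> torus torus_atlas snd x k) \<and>
     (\<forall>q\<in>torus. finite {x \<in> B. snd x = q} \<and> card {x \<in> B. snd x = q} = m)"
proof -
  have cov: "covering_space B snd torus"
    using assms by (simp add: without_branch_points_def)
  show ?thesis
    unfolding surface_braid_def oriented_simple_branched_covering_def
      oriented_branched_covering_def Let_def covering_space_no_branch_points[OF cov]
    using cov covering_space_imp_surjective[OF cov] covering_space_imp_continuous[OF cov]
    by auto
qed

lemma surface_braid_pullback:
  assumes B: "surface_braid m B \<A>" "without_branch_points B" and B': "B' \<subseteq> braid_space"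
    and H: "homeomorphism B' B H G" and fib: "\<And>x. x \<in> B' \<Longrightarrow> snd (H x) = snd x"
  shows "surface_braid m B' (pullback_chart B' H ` \<A>)"
proof -
  note iff = unbranched_surface_braid_iff[OF B(2)]
  have "covering_space B snd torus"
    using B(2) by (simp add: without_branch_points_def)
  then have wbp: "without_branch_points B'"
    unfolding without_branch_points_def by (rule covering_space_pullback[OF H]) (simp add: fib)
  have S: "oriented_surface B \<A>" and "compact B"
    using B(1) by (auto simp: iff)
  have "compact B'"
    using \<open>compact B\<close> H by (metis compact_continuous_image homeomorphism_cont2 homeomorphism_image2)
  moreover have "\<exists>k\<ge>1. local_power_map B' (pullback_chart B' H ` \<A>) torus torus_atlas snd x k"
    if "x \<in> B'" for x
  proof -
    have "H x \<in> B" using H that by (auto simp: homeomorphism_def)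
    then obtain k where "k \<ge> 1" "local_power_map B \<A> torus torus_atlas snd (H x) k"
      using B(1) by (auto simp: iff)
    then show ?thesis
      using local_power_map_pullback[OF H S that] fib by metis
  qed
  moreover have "finite {x \<in> B'. snd x = q} \<and> card {x \<in> B'. snd x = q} = m" if q: "q \<in> torus" for q
  proof -
    have "bij_betw H {x \<in> B'. snd x = q} {x \<in> B. snd x = q}"
    proof (rule bij_betwI[where g = G])
      show "H \<in> {x \<in> B'. snd x = q} \<rightarrow> {x \<in> B. snd x = q}"
        using H fib by (auto simp: homeomorphism_def)
      show "G \<in> {x \<in> B. snd x = q} \<rightarrow> {x \<in> B'. snd x = q}"
        using H fib by (auto simp: homeomorphism_def)
    qed (use H in \<open>auto simp: homeomorphism_def\<close>)
    then show ?thesis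
      using B(1) q by (auto simp: iff bij_betw_finite bij_betw_same_card)
  qed
  ultimately show ?thesis
    unfolding unbranched_surface_braid_iff[OF wbp]
    using B' oriented_surface_pullback[OF H S] by auto
qed

text \<open>
  Taking the pulled-back atlas on \<open>B'\<close>, rather than one built from the torus, makes the final stage of
  the isotopy carry the orientation of \<open>B'\<close> to that of \<open>B\<close> by construction.
\<close>

lemma surface_braid_via_isotopy:
  assumes B: "surface_braid m B \<A>" "without_branch_points B"
    and B': "B' \<subseteq> braid_space" and h: "fibre_preserving_isotopy h" "h 1 ` B' = B"
    and fib: "\<And>x. x \<in> B' \<Longrightarrow> snd (h 1 x) = snd x"
  shows "\<exists>\<A>'. surface_braid m B' \<A>' \<and> equivalent_surface_braids B' \<A>' B \<A>"
proof -
  obtain k where k: "homeomorphism braid_space braid_space (h 1) k"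
    using h(1) unfolding fibre_preserving_isotopy_def by (metis atLeastAtMost_iff order.refl zero_le_one)
  have S: "oriented_surface B \<A>" and BS: "B \<subseteq> braid_space"
    using B by (auto simp: surface_braid_def)
  have H: "homeomorphism B' B (h 1) k"
    by (rule homeomorphism_of_subsets[OF k B' BS h(2)])
  let ?\<A> = "pullback_chart B' (h 1) ` \<A>"
  have "oriented_chart B \<A> (h 1 ` U', \<phi>' \<circ> inv_into braid_space (h 1))" if mem: "(U', \<phi>') \<in> ?\<A>" for U' \<phi>'
  proof -
    obtain U \<phi> where U: "(U, \<phi>) \<in> \<A>" "U' = B' \<inter> h 1 -` U" "\<phi>' = \<phi> \<circ> h 1"
      using mem by (auto simp: pullback_chart_def)
    have c: "oriented_chart B \<A> (U, \<phi>)"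
      using S U(1) by (auto simp: oriented_surface_def oriented_chart_def)
    have UB: "U \<subseteq> B"
      using c is_chart_subset[of B U \<phi>] by (auto simp: oriented_chart_def)
    then have img: "h 1 ` U' = U"
      using h(2) U(2) by auto
    have "h 1 (inv_into braid_space (h 1) x) = x" if "x \<in> U" for x
      using that UB BS k by (intro f_inv_into_f) (auto simp: homeomorphism_def)
    then show ?thesis
      unfolding img by (intro oriented_chart_cong[OF S c]) (simp add: U(3))
  qed
  then have "\<forall>(U', \<phi>')\<in>?\<A>. oriented_chart B \<A> (h 1 ` U', \<phi>' \<circ> inv_into braid_space (h 1))"
    by blast
  then have "equivalent_surface_braids B' ?\<A> B \<A>"
    unfolding equivalent_surface_braids_def using h by blast
  then show ?thesis
    using surface_braid_pullback[OF B B' H fib] by blast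
qed


section \<open>Symmetric functions of the points of a fibre\<close>

lemma continuous_on_openin_cover:
  assumes "\<And>x. x \<in> S \<Longrightarrow> \<exists>N. openin (top_of_set S) N \<and> x \<in> N \<and> continuous_on N f"
  shows "continuous_on S f"
  unfolding continuous_on_def
proof
  fix x assume x: "x \<in> S"
  then obtain N W where N: "continuous_on N f" "N = S \<inter> W" "open W" "x \<in> W"
    using assms[OF x] by (auto simp: openin_open)
  then have "(f \<longlongrightarrow> f x) (at x within N)"
    using x by (auto simp: continuous_on_def)
  moreover have "at x within S = at x within N"
    using N by (intro at_within_nhd[of x W]) auto
  ultimately show "(f \<longlongrightarrow> f x) (at x within S)"
    by simp
qed

text \<open>
  The sheets over an evenly covered set serve as the index set of the sections. There are finitely many of
  them because they correspond to the points of one fibre.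
\<close>

lemma covering_space_local_sections:
  fixes B :: "'a::topological_space set" and T :: "'b::topological_space set"
  assumes cov: "covering_space B p T" and "q0 \<in> T" and fin: "finite {x \<in> B. p x = q0}"
  obtains N and I :: "'a set set" and s
  where "openin (top_of_set T) N" "q0 \<in> N" "finite I" "\<And>i. i \<in> I \<Longrightarrow> continuous_on N (s i)"
    "\<And>q. q \<in> N \<Longrightarrow> bij_betw (\<lambda>i. s i q) I {x \<in> B. p x = q}"
proof -
  obtain N \<V> where N: "q0 \<in> N" "openin (top_of_set T) N" and \<V>: "\<Union>\<V> = B \<inter> p -` N"
    "pairwise disjnt \<V>" "\<And>u. u \<in> \<V> \<Longrightarrow> \<exists>q. homeomorphism u N p q"
    using cov \<open>q0 \<in> T\<close> unfolding covering_space_def by metis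
  then obtain s where s: "\<And>u. u \<in> \<V> \<Longrightarrow> homeomorphism u N p (s u)"
    by metis
  have su: "s u q \<in> u" "p (s u q) = q" if "u \<in> \<V>" "q \<in> N" for u q
    using s[OF that(1)] that(2) by (auto simp: homeomorphism_def)
  have bij: "bij_betw (\<lambda>u. s u q) \<V> {x \<in> B. p x = q}" if q: "q \<in> N" for q
    unfolding bij_betw_def
  proof
    show "inj_on (\<lambda>u. s u q) \<V>"
    proof (rule inj_onI, rule ccontr)
      fix u v assume uv: "u \<in> \<V>" "v \<in> \<V>" "s u q = s v q" "u \<noteq> v"
      then have "s u q \<in> u" "s u q \<in> v"
        using su(1)[OF uv(1) q] su(1)[OF uv(2) q] by auto
      then show False
        using pairwiseD[OF \<V>(2) uv(1,2,4)] by (auto simp: disjnt_def)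
    qed
    have "x \<in> (\<lambda>u. s u q) ` \<V>" if x: "x \<in> B" "p x = q" for x
    proof -
      obtain u where u: "u \<in> \<V>" "x \<in> u"
        using x q \<V>(1) by blast
      then have "s u q = x"
        using s[OF u(1)] x(2) by (auto simp: homeomorphism_def)
      then show ?thesis using u(1) by blast
    qed
    moreover have "s u q \<in> B" if "u \<in> \<V>" for u
      using su(1)[OF that q] that \<V>(1) by blast
    ultimately show "(\<lambda>u. s u q) ` \<V> = {x \<in> B. p x = q}"
      using su(2) q by auto
  qed
  moreover have "finite \<V>"
    using bij_betw_finite[OF bij[OF N(1)]] fin by simp
  moreover have "continuous_on N (s u)" if "u \<in> \<V>" for u
    using s[OF that] by (rule homeomorphism_cont2)
  ultimately show thesis
    by (intro that[OF N(2,1), of \<V> s]) auto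
qed

text \<open>
  The parameter \<open>a\<close> will be a point of the plane. A sum over a fibre does not depend on the order of
  the local sections, hence it is continuous although the sections need not extend globally.
\<close>

lemma continuous_on_fibre_sum:
  fixes g :: "'c::topological_space \<times> 'a::topological_space \<Rightarrow> 'd::real_normed_vector"
  assumes cov: "covering_space B p T" and fin: "\<And>q. q \<in> T \<Longrightarrow> finite {x \<in> B. p x = q}"
    and g: "continuous_on (A \<times> B) g"
  shows "continuous_on (A \<times> T) (\<lambda>(a, q). \<Sum>x | x \<in> B \<and> p x = q. g (a, x))"
proof (rule continuous_on_openin_cover)
  fix z assume "z \<in> A \<times> T"
  then obtain a0 q0 where z: "z = (a0, q0)" "a0 \<in> A" "q0 \<in> T" by auto
  obtain N and I :: "'a set set" and s where N: "openin (top_of_set T) N" "q0 \<in> N"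
    and I: "finite I" and s: "\<And>i. i \<in> I \<Longrightarrow> continuous_on N (s i)"
    and bij: "\<And>q. q \<in> N \<Longrightarrow> bij_betw (\<lambda>i. s i q) I {x \<in> B. p x = q}"
    by (rule covering_space_local_sections[OF cov z(3) fin[OF z(3)]]) (rule that)
  have "continuous_on (A \<times> N) (\<lambda>z. g (fst z, s i (snd z)))" if i: "i \<in> I" for i
  proof (rule continuous_on_compose2[OF g])
    have "continuous_on (A \<times> N) (\<lambda>z. s i (snd z))"
      by (rule continuous_on_compose2[OF s[OF i] continuous_on_snd]) auto
    then show "continuous_on (A \<times> N) (\<lambda>z. (fst z, s i (snd z)))"
      by (intro continuous_intros)
    show "(\<lambda>z. (fst z, s i (snd z))) ` (A \<times> N) \<subseteq> A \<times> B"
      using bij_betw_apply[OF bij i] by auto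
  qed
  then have "continuous_on (A \<times> N) (\<lambda>z. \<Sum>i\<in>I. g (fst z, s i (snd z)))"
    by (rule continuous_on_sum)
  moreover have "(\<Sum>i\<in>I. g (fst z, s i (snd z))) = (\<lambda>(a, q). \<Sum>x | x \<in> B \<and> p x = q. g (a, x)) z"
    if "z \<in> A \<times> N" for z
    using that sum.reindex_bij_betw[OF bij] by (auto simp: split_beta)
  ultimately have "continuous_on (A \<times> N) (\<lambda>(a, q). \<Sum>x | x \<in> B \<and> p x = q. g (a, x))"
    by (rule continuous_on_eq)
  moreover have "openin (top_of_set (A \<times> T)) (A \<times> N)"
    using N by (intro openin_Times) auto
  ultimately show "\<exists>N. openin (top_of_set (A \<times> T)) N \<and> z \<in> N \<and>
      continuous_on N (\<lambda>(a, q). \<Sum>x | x \<in> B \<and> p x = q. g (a, x))"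
    using z N(2) by (intro exI[of _ "A \<times> N"]) simp
qed

lemma continuous_on_coeff_prod_linear:
  fixes c :: "'i \<Rightarrow> 'b::topological_space \<Rightarrow> complex"
  assumes "finite I" and "\<And>i. i \<in> I \<Longrightarrow> continuous_on N (c i)"
  shows "continuous_on N (\<lambda>q. coeff (\<Prod>i\<in>I. [:- c i q, 1:]) j)"
  using assms
proof (induction I arbitrary: j rule: finite_induct)
  case (insert i I)
  let ?P = "\<lambda>q. \<Prod>i\<in>I. [:- c i q, 1:]"
  have IH: "continuous_on N (\<lambda>q. coeff (?P q) j)" for j
    using insert by auto
  have "continuous_on N (\<lambda>q. coeff (pCons 0 (?P q)) j)"
    by (cases j) (auto intro: IH)
  moreover have "continuous_on N (c i)"
    using insert by auto
  ultimately have "continuous_on N (\<lambda>q. - (c i q * coeff (?P q) j) + coeff (pCons 0 (?P q)) j)"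
    using IH by (intro continuous_intros)
  then show ?case
    using insert(1,2) by (simp add: mult_pCons_left)
qed auto

text \<open>
  The coefficients are, up to sign, the elementary symmetric functions of the values of \<open>r\<close> on the fibre.
\<close>

lemma continuous_on_coeff_fibre_poly:
  fixes r :: "'a::topological_space \<Rightarrow> complex"
  assumes cov: "covering_space B p T" and fin: "\<And>q. q \<in> T \<Longrightarrow> finite {x \<in> B. p x = q}"
    and r: "continuous_on B r"
  shows "continuous_on T (\<lambda>q. coeff (\<Prod>x | x \<in> B \<and> p x = q. [:- r x, 1:]) j)"
proof (rule continuous_on_openin_cover)
  fix q0 assume q0: "q0 \<in> T"
  obtain N and I :: "'a set set" and s where N: "openin (top_of_set T) N" "q0 \<in> N"
    and I: "finite I" and s: "\<And>i. i \<in> I \<Longrightarrow> continuous_on N (s i)"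
    and bij: "\<And>q. q \<in> N \<Longrightarrow> bij_betw (\<lambda>i. s i q) I {x \<in> B. p x = q}"
    by (rule covering_space_local_sections[OF cov q0 fin[OF q0]]) (rule that)
  have "continuous_on N (\<lambda>q. r (s i q))" if "i \<in> I" for i
    by (rule continuous_on_compose2[OF r s[OF that]]) (use bij_betw_apply[OF bij that] in auto)
  then have "continuous_on N (\<lambda>q. coeff (\<Prod>i\<in>I. [:- r (s i q), 1:]) j)"
    using I by (intro continuous_on_coeff_prod_linear) auto
  then have "continuous_on N (\<lambda>q. coeff (\<Prod>x | x \<in> B \<and> p x = q. [:- r x, 1:]) j)"
    by (rule continuous_on_eq) (simp add: prod.reindex_bij_betw[OF bij, symmetric])
  then show "\<exists>N. openin (top_of_set T) N \<and> q0 \<in> N \<and>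
      continuous_on N (\<lambda>q. coeff (\<Prod>x | x \<in> B \<and> p x = q. [:- r x, 1:]) j)"
    using N by blast
qed

text \<open>
  By the Lebesgue number lemma for a cover of \<open>B\<close> by open sets on which \<open>p\<close> is injective: two points of
  \<open>B\<close> closer than the Lebesgue number lie in one of these sets.
\<close>

lemma covering_space_fibre_separation:
  fixes p :: "'a::metric_space \<Rightarrow> 'b::topological_space"
  assumes cov: "covering_space B p T" and "compact B"
  obtains \<epsilon> where "0 < \<epsilon>"
    "\<And>x y. \<lbrakk>x \<in> B; y \<in> B; p x = p y; dist x y < \<epsilon>\<rbrakk> \<Longrightarrow> x = y"
proof -
  define \<C> where "\<C> = {W. open W \<and> inj_on p (B \<inter> W)}"
  have cover: "B \<subseteq> \<Union>\<C>"
  proof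
    fix x assume x: "x \<in> B"
    obtain U u q where U: "x \<in> U" "openin (top_of_set B) U" "homeomorphism U u p q"
      using covering_space_local_homeomorphism[OF cov x] by metis
    then have "inj_on p U"
      by (auto simp: homeomorphism_def intro: inj_on_inverseI)
    then show "x \<in> \<Union>\<C>"
      using U(1,2) by (auto simp: \<C>_def openin_open)
  qed
  have ne: "\<C> \<noteq> {}"
    by (auto simp: \<C>_def intro: exI[of _ "{}"])
  have "open W" if "W \<in> \<C>" for W
    using that by (simp add: \<C>_def)
  from Lebesgue_number_lemma[OF \<open>compact B\<close> ne cover this]
  obtain \<delta> where \<delta>: "0 < \<delta>" "\<And>A. \<lbrakk>A \<subseteq> B; diameter A < \<delta>\<rbrakk> \<Longrightarrow> \<exists>W\<in>\<C>. A \<subseteq> W"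
    by blast
  have "x = y" if xy: "x \<in> B" "y \<in> B" "p x = p y" "dist x y < \<delta>" for x y
  proof -
    have "diameter {x, y} \<le> dist x y"
      by (auto simp: diameter_def dist_commute intro!: cSup_least)
    then obtain W where "inj_on p (B \<inter> W)" "x \<in> W" "y \<in> W"
      using \<delta>(2)[of "{x, y}"] xy by (auto simp: \<C>_def)
    then show ?thesis
      using xy by (auto dest: inj_onD)
  qed
  then show thesis
    using \<delta>(1) that by blast
qed


section \<open>Ambient isotopy between close surfaces\<close>

text \<open>
  On each fibre the map is the identity plus a contraction, so the Banach fixed point theorem inverts it:
  the preimage of \<open>y\<close> is the fixed point of \<open>u \<mapsto> y - \<sigma> (u, q)\<close>. The contraction constant is the same on all
  fibres, which makes this fixed point depend continuously on \<open>y\<close> and \<open>q\<close> jointly.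
\<close>

lemma homeomorphism_fibrewise_perturbation:
  fixes \<sigma> :: "'a::banach \<times> 'b::metric_space \<Rightarrow> 'a"
  assumes cont: "continuous_on (UNIV \<times> T) \<sigma>"
    and lip: "\<And>q u u'. q \<in> T \<Longrightarrow> norm (\<sigma> (u, q) - \<sigma> (u', q)) \<le> norm (u - u') / 2"
  shows "\<exists>k. homeomorphism (UNIV \<times> T) (UNIV \<times> T) (\<lambda>(u, q). (u + \<sigma> (u, q), q)) k"
proof -
  have ex1: "\<exists>!u. y - \<sigma> (u, q) = u" if q: "q \<in> T" for y q
    by (rule banach_fix_type[where c = "1/2"])
      (use lip[OF q] in \<open>auto simp: dist_norm norm_minus_commute\<close>)
  define \<xi> where "\<xi> y q = (THE u. y - \<sigma> (u, q) = u)" for y q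
  have \<xi>: "y - \<sigma> (\<xi> y q, q) = \<xi> y q" if "q \<in> T" for y q
    unfolding \<xi>_def by (rule theI'[OF ex1[OF that]])
  have \<xi>_cont: "continuous_on (UNIV \<times> T) (\<lambda>z. \<xi> (fst z) (snd z))"
    unfolding continuous_on_def
  proof
    fix z0 :: "'a \<times> 'b" assume z0: "z0 \<in> UNIV \<times> T"
    obtain y0 q0 where yq: "z0 = (y0, q0)" "q0 \<in> T" using z0 by auto
    define u0 where "u0 = \<xi> y0 q0"
    let ?F = "at z0 within UNIV \<times> T"
    let ?b = "\<lambda>z. 2 * norm (fst z - y0) + 2 * norm (\<sigma> (u0, snd z) - \<sigma> (u0, q0))"
    have "continuous_on (UNIV \<times> T) (\<lambda>z::'a \<times> 'b. \<sigma> (u0, snd z))"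
      by (rule continuous_on_compose2[OF cont]) (auto intro!: continuous_intros)
    then have "continuous_on (UNIV \<times> T) ?b"
      by (intro continuous_intros)
    then have "(?b \<longlongrightarrow> ?b z0) ?F"
      using z0 unfolding continuous_on_def by blast
    then have lim: "(?b \<longlongrightarrow> 0) ?F"
      by (simp add: yq)
    \<comment> \<open>Only the fixed point \<open>u0\<close> enters the bound, so continuity of \<open>\<sigma>\<close> along \<open>u0\<close> is enough.\<close>
    have bound: "norm (\<xi> y q - u0) \<le> ?b (y, q)" if q: "q \<in> T" for y q
    proof -
      let ?d = "\<xi> y q - u0"
      have u0: "y0 - \<sigma> (u0, q0) = u0"
        unfolding u0_def by (rule \<xi>[OF yq(2)])
      have "?d = (y - \<sigma> (\<xi> y q, q)) - (y0 - \<sigma> (u0, q0))"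
        unfolding u0 \<xi>[OF q] ..
      also have "\<dots> = (y - y0) - (\<sigma> (\<xi> y q, q) - \<sigma> (u0, q)) - (\<sigma> (u0, q) - \<sigma> (u0, q0))"
        by simp
      also have "norm \<dots> \<le> norm (y - y0) + norm (\<sigma> (\<xi> y q, q) - \<sigma> (u0, q))
          + norm (\<sigma> (u0, q) - \<sigma> (u0, q0))"
        by (intro order_trans[OF norm_triangle_ineq4] add_mono norm_triangle_ineq4 order.refl)
      finally have "norm ?d \<le> norm (y - y0) + norm (\<sigma> (\<xi> y q, q) - \<sigma> (u0, q))
          + norm (\<sigma> (u0, q) - \<sigma> (u0, q0))" .
      then show ?thesis
        using lip[OF q, of "\<xi> y q" u0] by simp
    qed
    have "((\<lambda>z. \<xi> (fst z) (snd z) - u0) \<longlongrightarrow> 0) ?F"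
    proof (rule Lim_null_comparison[OF _ lim])
      show "\<forall>\<^sub>F z in ?F. norm (\<xi> (fst z) (snd z) - u0) \<le> ?b z"
        unfolding eventually_at_filter by (rule always_eventually) (auto intro: order_trans[OF bound])
    qed
    then show "((\<lambda>z. \<xi> (fst z) (snd z)) \<longlongrightarrow> \<xi> (fst z0) (snd z0)) ?F"
      by (simp add: LIM_zero_iff yq u0_def)
  qed
  have "homeomorphism (UNIV \<times> T) (UNIV \<times> T) (\<lambda>z. (fst z + \<sigma> z, snd z))
      (\<lambda>z. (\<xi> (fst z) (snd z), snd z))"
  proof
    show "continuous_on (UNIV \<times> T) (\<lambda>z. (fst z + \<sigma> z, snd z))"
      using cont by (intro continuous_intros)
    show "continuous_on (UNIV \<times> T) (\<lambda>z. (\<xi> (fst z) (snd z), snd z))"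
      using \<xi>_cont by (intro continuous_intros)
    fix z :: "'a \<times> 'b" assume "z \<in> UNIV \<times> T"
    then obtain u q where z: "z = (u, q)" "q \<in> T" by auto
    have "\<xi> (u + \<sigma> (u, q)) q = u"
      unfolding \<xi>_def by (rule the1_equality[OF ex1[OF z(2)]]) simp
    then show "(\<xi> (fst (fst z + \<sigma> z, snd z)) (snd (fst z + \<sigma> z, snd z)), snd (fst z + \<sigma> z, snd z)) = z"
      by (simp add: z)
    show "(fst (\<xi> (fst z) (snd z), snd z) + \<sigma> (\<xi> (fst z) (snd z), snd z), snd (\<xi> (fst z) (snd z), snd z)) = z"
      using \<xi>[OF z(2), of u, unfolded diff_eq_eq, symmetric] by (simp add: z)
  qed auto
  then show ?thesis
    unfolding case_prod_beta' prod.collapse by blast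
qed

lemma bump_lipschitz:
  fixes a b :: real
  assumes "0 < \<delta>"
  shows "\<bar>max 0 (1 - a / \<delta>) - max 0 (1 - b / \<delta>)\<bar> \<le> \<bar>a - b\<bar> / \<delta>"
proof -
  have "\<bar>max 0 (1 - a / \<delta>) - max 0 (1 - b / \<delta>)\<bar> \<le> \<bar>a / \<delta> - b / \<delta>\<bar>"
    by (auto simp: max_def)
  then show ?thesis
    using assms by (simp add: diff_divide_distrib[symmetric])
qed

text \<open>
  The surface formed by the points \<open>(r x, snd x)\<close> is pushed back to \<open>B\<close> along the vector field \<open>\<sigma>\<close>,
  a sum of the displacements \<open>fst x - r x\<close>, each weighted by a bump \<open>\<beta>\<close> of height \<open>1\<close> and radius \<open>\<delta>\<close> around
  \<open>r x\<close>. The bumps of one fibre vanish at each other's centres, so \<open>\<sigma>\<close> has the prescribed values there.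
  Each summand has Lipschitz constant \<open>\<eta> / \<delta>\<close>, and \<open>m * \<eta> \<le> \<delta> / 2\<close> bounds that of their sum by
  \<open>1/2\<close>; hence every stage of the straight-line isotopy along \<open>\<sigma>\<close> is a homeomorphism.
\<close>

lemma isotopy_to_close_surface:
  assumes B: "B \<subseteq> braid_space" and cov: "covering_space B snd torus"
    and card: "\<And>q. q \<in> torus \<Longrightarrow> finite {x \<in> B. snd x = q} \<and> card {x \<in> B. snd x = q} = m"
    and r: "continuous_on B r"
    and sep: "\<And>x y. \<lbrakk>x \<in> B; y \<in> B; snd x = snd y; x \<noteq> y\<rbrakk> \<Longrightarrow> \<delta> \<le> norm (r x - r y)"
    and close: "\<And>x. x \<in> B \<Longrightarrow> norm (fst x - r x) \<le> \<eta>"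
    and \<delta>: "0 < \<delta>" "m * \<eta> \<le> \<delta> / 2"
  shows "\<exists>h. fibre_preserving_isotopy h \<and> h 1 ` (\<lambda>x. (r x, snd x)) ` B = B \<and>
    (\<forall>x. snd (h 1 x) = snd x)"
proof -
  define \<beta> where "\<beta> u x = max 0 (1 - norm (u - r x) / \<delta>)" for u :: complex and x :: point
  define \<sigma> where "\<sigma> = (\<lambda>(u, q). \<Sum>x | x \<in> B \<and> snd x = q. \<beta> u x *\<^sub>R (fst x - r x))"
  define h where "h t = (\<lambda>(u, q). (u + t *\<^sub>R \<sigma> (u, q), q))" for t :: real
  have \<beta>_cont: "continuous_on (UNIV \<times> B) (\<lambda>z. \<beta> (fst z) (snd z))"
    unfolding \<beta>_def using \<delta>(1)
    by (intro continuous_intros continuous_on_compose2[OF r]) auto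
  have "continuous_on (UNIV \<times> torus)
      (\<lambda>(u, q). \<Sum>x | x \<in> B \<and> snd x = q. (\<lambda>z. \<beta> (fst z) (snd z) *\<^sub>R (fst (snd z) - r (snd z))) (u, x))"
    using card \<beta>_cont by (intro continuous_on_fibre_sum[OF cov] continuous_intros continuous_on_compose2[OF r]) auto
  then have \<sigma>_cont: "continuous_on braid_space \<sigma>"
    by (simp add: \<sigma>_def braid_space_def)
  have \<sigma>_lip: "norm (\<sigma> (u, q) - \<sigma> (u', q)) \<le> norm (u - u') / 2" if q: "q \<in> torus" for u u' q
  proof -
    let ?X = "{x \<in> B. snd x = q}"
    have "norm (\<beta> u x *\<^sub>R (fst x - r x) - \<beta> u' x *\<^sub>R (fst x - r x)) \<le> norm (u - u') / \<delta> * \<eta>"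
      if x: "x \<in> ?X" for x
    proof -
      have "\<bar>\<beta> u x - \<beta> u' x\<bar> \<le> \<bar>norm (u - r x) - norm (u' - r x)\<bar> / \<delta>"
        unfolding \<beta>_def by (rule bump_lipschitz[OF \<delta>(1)])
      also have "\<dots> \<le> norm (u - u') / \<delta>"
        using norm_triangle_ineq3[of "u - r x" "u' - r x"] \<delta>(1) by (simp add: divide_right_mono)
      finally have "\<bar>\<beta> u x - \<beta> u' x\<bar> * norm (fst x - r x) \<le> norm (u - u') / \<delta> * \<eta>"
        using close x \<delta>(1) by (intro mult_mono) auto
      then show ?thesis
        by (simp add: scaleR_diff_left[symmetric])
    qed
    then have "norm (\<Sum>x\<in>?X. \<beta> u x *\<^sub>R (fst x - r x) - \<beta> u' x *\<^sub>R (fst x - r x))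
        \<le> card ?X * (norm (u - u') / \<delta> * \<eta>)"
      by (rule sum_norm_bound)
    also have "\<dots> = norm (u - u') * (m * \<eta>) / \<delta>"
      using card[OF q] by simp
    also have "\<dots> \<le> norm (u - u') * (\<delta> / 2) / \<delta>"
      using \<delta> by (intro divide_right_mono mult_left_mono) auto
    finally show ?thesis
      using \<delta>(1) by (simp add: \<sigma>_def sum_subtractf)
  qed
  have \<sigma>_root: "\<sigma> (r x, snd x) = fst x - r x" if x: "x \<in> B" for x
  proof -
    have "snd x \<in> torus"
      using x B by (auto simp: braid_space_def)
    then have fin: "finite {y \<in> B. snd y = snd x}"
      using card by blast
    have "\<beta> (r x) y *\<^sub>R (fst y - r y) = (if y = x then fst y - r y else 0)"
      if "y \<in> {y \<in> B. snd y = snd x}" for y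
      using sep[OF x, of y] that \<delta>(1) by (auto simp: \<beta>_def)
    then have "\<sigma> (r x, snd x) = (\<Sum>y | y \<in> B \<and> snd y = snd x. if y = x then fst y - r y else 0)"
      unfolding \<sigma>_def prod.case by (rule sum.cong[OF refl])
    then show ?thesis
      using x fin by simp
  qed
  have "fibre_preserving_isotopy h"
    unfolding fibre_preserving_isotopy_def
  proof (intro conjI ballI)
    have "continuous_on ({0..1} \<times> braid_space) (\<lambda>z. \<sigma> (fst (snd z), snd (snd z)))"
      by (rule continuous_on_compose2[OF \<sigma>_cont]) (auto intro!: continuous_intros simp: braid_space_def)
    then have "continuous_on ({0..1} \<times> braid_space)
        (\<lambda>z. (fst (snd z) + fst z *\<^sub>R \<sigma> (fst (snd z), snd (snd z)), snd (snd z)))"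
      by (intro continuous_intros)
    then show "continuous_on ({0..1} \<times> braid_space) (\<lambda>(t, x). h t x)"
      by (simp add: h_def split_beta)
  next
    fix x show "h 0 x = x" by (simp add: h_def split_beta)
  next
    fix t :: real assume t: "t \<in> {0..1}"
    have "norm (t *\<^sub>R \<sigma> (u, q) - t *\<^sub>R \<sigma> (u', q)) \<le> norm (u - u') / 2" if "q \<in> torus" for u u' q
    proof -
      have "norm (t *\<^sub>R \<sigma> (u, q) - t *\<^sub>R \<sigma> (u', q)) = t * norm (\<sigma> (u, q) - \<sigma> (u', q))"
        using t by (simp add: scaleR_diff_right[symmetric])
      also have "\<dots> \<le> 1 * (norm (u - u') / 2)"
        using t \<sigma>_lip[OF that] by (intro mult_mono) auto
      finally show ?thesis by simp
    qed
    moreover have "continuous_on (UNIV \<times> torus) (\<lambda>z. t *\<^sub>R \<sigma> z)"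
      using \<sigma>_cont unfolding braid_space_def by (intro continuous_intros)
    ultimately have "\<exists>k. homeomorphism (UNIV \<times> torus) (UNIV \<times> torus)
        (\<lambda>(u, q). (u + t *\<^sub>R \<sigma> (u, q), q)) k"
      by (intro homeomorphism_fibrewise_perturbation) auto
    then show "\<exists>h'. homeomorphism braid_space braid_space (h t) h'"
      by (simp add: h_def braid_space_def)
    show "\<exists>g g'. homeomorphism torus torus g g' \<and> (\<forall>x\<in>braid_space. snd (h t x) = g (snd x))"
      using homeomorphism_ident[of torus]
      by (intro exI[of _ "\<lambda>q. q"]) (auto simp: h_def split_beta)
  qed
  moreover have "h 1 (r x, snd x) = x" if "x \<in> B" for x
    using \<sigma>_root[OF that] by (simp add: h_def)
  then have "h 1 ` (\<lambda>x. (r x, snd x)) ` B = B"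
    by (simp add: image_image)
  moreover have "\<forall>x. snd (h 1 x) = snd x"
    by (simp add: h_def split_beta)
  ultimately show ?thesis
    by blast
qed


section \<open>Roots of close monic polynomials\<close>

text \<open>
  The two conditions on \<open>z\<close> are closed, so the graph of \<open>r\<close> is closed, and \<open>r\<close> takes its values
  in a compact ball.
\<close>

lemma continuous_on_unique_close_zero:
  fixes r c :: "'a::euclidean_space \<Rightarrow> 'b::euclidean_space" and F :: "'a \<times> 'b \<Rightarrow> 'c::real_normed_vector"
  assumes B: "compact B" and F: "continuous_on (B \<times> UNIV) F" and c: "continuous_on B c"
    and r: "\<And>x z. x \<in> B \<Longrightarrow> F (x, z) = 0 \<and> norm (z - c x) \<le> \<eta> \<longleftrightarrow> z = r x"
  shows "continuous_on B r"
proof -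
  have "bounded (c ` B)"
    using B c by (intro compact_imp_bounded compact_continuous_image)
  then obtain M where M: "\<And>x. x \<in> B \<Longrightarrow> norm (c x) \<le> M"
    by (auto simp: bounded_iff)
  have zero: "F (x, r x) = 0" and near: "norm (r x - c x) \<le> \<eta>" if "x \<in> B" for x
    using r[OF that, of "r x"] by simp_all
  let ?S = "B \<times> (UNIV :: 'b set)"
  let ?d = "\<lambda>z. norm (snd z - c (fst z))"
  have closed: "closed ?S"
    using B by (intro closed_Times compact_imp_closed closed_UNIV)
  have "continuous_on ?S ?d"
    by (intro continuous_intros continuous_on_compose2[OF c]) auto
  then have "closed (?S \<inter> ?d -` {..\<eta>})"
    using closed by (rule continuous_closed_preimage) simp
  moreover have "closed (?S \<inter> F -` {0})"
    using F closed by (rule continuous_closed_preimage) simp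
  moreover have "(\<lambda>x. (x, r x)) ` B = (?S \<inter> F -` {0}) \<inter> (?S \<inter> ?d -` {..\<eta>})"
    using zero near by (auto simp: r[symmetric] image_iff)
  ultimately have "closed ((\<lambda>x. (x, r x)) ` B)"
    by (simp add: closed_Int)
  moreover have "r \<in> B \<rightarrow> cball 0 (M + \<eta>)"
  proof
    fix x assume x: "x \<in> B"
    have "norm (r x) \<le> norm (c x) + norm (r x - c x)"
      using norm_triangle_sub by blast
    then show "r x \<in> cball 0 (M + \<eta>)"
      using M[OF x] near[OF x] by simp
  qed
  ultimately show ?thesis
    by (intro continuous_from_closed_graph[OF compact_cball])
qed

definition monic_poly :: "nat \<Rightarrow> (nat \<Rightarrow> 'a::comm_ring_1) \<Rightarrow> 'a poly" where
  "monic_poly m a = monom 1 m + (\<Sum>j<m. monom (a j) j)"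

lemma coeff_monic_poly: "coeff (monic_poly m a) j = (if j < m then a j else if j = m then 1 else 0)"
  by (auto simp: monic_poly_def coeff_sum)

lemma degree_monic_poly [simp]: "degree (monic_poly m a) = m"
  by (rule antisym) (auto intro!: degree_le le_degree simp: coeff_monic_poly)

lemma poly_monic_poly: "poly (monic_poly m a) z = z ^ m + (\<Sum>j<m. a j * z ^ j)"
  by (simp add: monic_poly_def poly_sum poly_monom)

text \<open>
  The leading terms cancel in \<open>P - Q\<close>, so only the \<open>m\<close> lower coefficients contribute.
\<close>

lemma norm_poly_at_root_of_close_poly:
  fixes P Q :: "complex poly"
  assumes deg: "degree P = m" "degree Q = m" and monic: "lead_coeff P = 1" "lead_coeff Q = 1"
    and close: "\<And>j. j < m \<Longrightarrow> norm (coeff P j - coeff Q j) \<le> e"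
    and z: "poly Q z = 0" "norm z \<le> M" "1 \<le> M"
  shows "norm (poly P z) \<le> m * e * M ^ m"
proof -
  have "poly P z = poly P z - poly Q z"
    using z by simp
  also have "\<dots> = (\<Sum>j\<le>m. (coeff P j - coeff Q j) * z ^ j)"
    unfolding poly_altdef deg by (simp add: sum_subtractf algebra_simps)
  also have "\<dots> = (\<Sum>j<m. (coeff P j - coeff Q j) * z ^ j)"
    using deg monic by (simp add: lessThan_Suc_atMost[symmetric])
  also have "norm \<dots> \<le> (\<Sum>j<m. norm ((coeff P j - coeff Q j) * z ^ j))"
    by (rule norm_sum)
  also have "\<dots> \<le> (\<Sum>j<m. e * M ^ m)"
  proof (rule sum_mono)
    fix j assume j: "j \<in> {..<m}"
    have "norm z ^ j \<le> M ^ j"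
      using z by (intro power_mono) auto
    also have "\<dots> \<le> M ^ m"
      using z j by (intro power_increasing) auto
    finally show "norm ((coeff P j - coeff Q j) * z ^ j) \<le> e * M ^ m"
      unfolding norm_mult norm_power using close j by (intro mult_mono) (auto intro: order_trans[OF norm_ge_zero])
  qed
  finally show ?thesis
    by simp
qed

lemma norm_poly_ge_of_far_roots:
  fixes A :: "complex multiset"
  assumes "0 \<le> \<eta>" and "\<And>z. z \<in># A \<Longrightarrow> \<eta> \<le> norm (x - z)"
  shows "\<eta> ^ size A \<le> norm (poly (\<Prod>z\<in>#A. [:- z, 1:]) x)"
  using assms(2)
proof (induction A)
  case (add z A)
  have "\<eta> * \<eta> ^ size A \<le> norm (x - z) * norm (poly (\<Prod>z\<in>#A. [:- z, 1:]) x)"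
    using add assms(1) by (intro mult_mono) auto
  then show ?case
    by (simp add: norm_mult[symmetric] left_diff_distrib)
qed simp

text \<open>
  The norm of \<open>P\<close> at \<open>x\<close> is the product of the distances of \<open>x\<close> from the roots.
\<close>

lemma root_near_almost_root:
  fixes P :: "complex poly"
  assumes "lead_coeff P = 1" "0 \<le> \<eta>" "norm (poly P x) < \<eta> ^ degree P"
  shows "\<exists>z. poly P z = 0 \<and> norm (z - x) < \<eta>"
proof -
  obtain A where A: "size A = degree P" "P = (\<Prod>z\<in>#A. [:- z, 1:])"
    using alg_closed_imp_factorization[of P] assms(1) by fastforce
  then obtain z where z: "z \<in># A" "norm (x - z) < \<eta>"
    using norm_poly_ge_of_far_roots[of \<eta> A x] assms(2,3) by (metis not_le)
  then have "[:- z, 1:] dvd P"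
    unfolding A(2) by (intro dvd_prod_mset) simp
  then show ?thesis
    using z(2) by (auto simp: poly_eq_0_iff_dvd norm_minus_commute)
qed

text \<open>
  By the separation, no root can be near two points of \<open>X\<close>. So there are at least as many roots near
  points of \<open>X\<close> as the degree allows, and they are all the roots of \<open>P\<close>. That the root is unique even
  in the closed disc makes its graph closed when \<open>P\<close> varies, and hence the root continuous.
\<close>

lemma roots_near_separated_almost_roots:
  fixes P :: "complex poly"
  assumes P: "lead_coeff P = 1" and X: "finite X" "card X = degree P"
    and small: "\<And>x. x \<in> X \<Longrightarrow> norm (poly P x) < \<eta> ^ degree P" and "0 < \<eta>"
    and sep: "\<And>x y. \<lbrakk>x \<in> X; y \<in> X; x \<noteq> y\<rbrakk> \<Longrightarrow> 2 * \<eta> \<le> norm (x - y)"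
  shows "\<exists>f. f ` X = {z. poly P z = 0} \<and>
    (\<forall>x\<in>X. \<forall>z. poly P z = 0 \<and> norm (z - x) \<le> \<eta> \<longleftrightarrow> z = f x)"
proof -
  have "\<exists>z. poly P z = 0 \<and> norm (z - x) < \<eta>" if "x \<in> X" for x
    using root_near_almost_root[OF P _ small[OF that]] \<open>0 < \<eta>\<close> by simp
  then obtain f where f: "\<And>x. x \<in> X \<Longrightarrow> poly P (f x) = 0 \<and> norm (f x - x) < \<eta>"
    by metis
  have near: "x = y" if "x \<in> X" "y \<in> X" "norm (f y - x) \<le> \<eta>" for x y
  proof (rule ccontr)
    assume "x \<noteq> y"
    moreover have "norm (x - y) \<le> norm (f y - x) + norm (f y - y)"
      using norm_triangle_ineq4[of "f y - y" "f y - x"] by simp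
    ultimately show False
      using sep[OF that(1,2)] f[OF that(2)] that(3) by simp
  qed
  have "P \<noteq> 0"
    using P by auto
  have "inj_on f X"
  proof (rule inj_onI)
    fix x y assume "x \<in> X" "y \<in> X" "f x = f y"
    then show "x = y"
      using f[of x] by (intro near) (auto simp: less_imp_le)
  qed
  then have "card (f ` X) = degree P"
    using X by (simp add: card_image)
  then have img: "f ` X = {z. poly P z = 0}"
    using f poly_roots_finite[OF \<open>P \<noteq> 0\<close>] card_poly_roots_bound[OF \<open>P \<noteq> 0\<close>]
    by (intro card_seteq) auto
  have "poly P z = 0 \<and> norm (z - x) \<le> \<eta> \<longleftrightarrow> z = f x" if x: "x \<in> X" for x z
  proof
    assume z: "poly P z = 0 \<and> norm (z - x) \<le> \<eta>"
    then have "z \<in> f ` X"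
      unfolding img by simp
    then show "z = f x"
      using near[OF x] z by blast
  qed (use f[OF x] in auto)
  then show ?thesis
    using img by (intro exI[of _ f] conjI ballI allI)
qed


section \<open>Laurent polynomials on the torus\<close>

text \<open>
  \<open>\<complex>[v, w]\<close> is rendered as \<open>\<complex>[w][v]\<close>, the coefficient ring of the polynomials in \<open>u\<close>.
\<close>

definition eval_vw :: "complex poly poly \<Rightarrow> complex \<Rightarrow> complex \<Rightarrow> complex" where
  "eval_vw Q v w = poly (poly Q [:v:]) w"

lemma eval_vw_simps [simp]:
  "eval_vw (P + Q) v w = eval_vw P v w + eval_vw Q v w"
  "eval_vw (P * Q) v w = eval_vw P v w * eval_vw Q v w"
  "eval_vw (P ^ k) v w = eval_vw P v w ^ k"
  by (simp_all add: eval_vw_def poly_power)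

lemma eval_vw_sum: "eval_vw (\<Sum>i\<in>I. P i) v w = (\<Sum>i\<in>I. eval_vw (P i) v w)"
  by (simp add: eval_vw_def poly_sum)

abbreviation monomial_vw :: "complex poly poly" where
  "monomial_vw \<equiv> [:0, [:0, 1:]:]"

lemma eval_vw_atoms [simp]:
  "eval_vw [:[:c:]:] v w = c"
  "eval_vw [:0, 1:] v w = v"
  "eval_vw [:[:0, 1:]:] v w = w"
  "eval_vw monomial_vw v w = v * w"
  by (simp_all add: eval_vw_def)

text \<open>
  The same exponent for \<open>v\<close> and \<open>w\<close> is no restriction for Laurent polynomials, since missing
  factors can be moved into \<open>Q\<close>, and it keeps the bookkeeping to one number.
\<close>

definition laurent_on_torus :: "(complex \<times> complex \<Rightarrow> complex) \<Rightarrow> bool" where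
  "laurent_on_torus g \<longleftrightarrow>
     (\<exists>N Q. \<forall>v w. (v, w) \<in> torus \<longrightarrow> eval_vw Q v w = (v * w) ^ N * g (v, w))"

lemma laurent_on_torus_cong:
  "\<lbrakk>laurent_on_torus f; \<And>q. q \<in> torus \<Longrightarrow> g q = f q\<rbrakk> \<Longrightarrow> laurent_on_torus g"
  by (simp add: laurent_on_torus_def)

lemma laurent_on_torusI:
  "(\<And>v w. (v, w) \<in> torus \<Longrightarrow> eval_vw Q v w = (v * w) ^ N * g (v, w)) \<Longrightarrow> laurent_on_torus g"
  unfolding laurent_on_torus_def by blast

lemma laurent_on_torus_const: "laurent_on_torus (\<lambda>q. c)"
  by (rule laurent_on_torusI[of "[:[:c:]:]" 0]) simp

lemma torus_unit:
  assumes "(v, w) \<in> torus"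
  shows "v * cnj v = 1" "w * cnj w = 1"
  using assms by (auto simp: torus_def complex_norm_square[symmetric])

text \<open>
  On the torus \<open>cnj v\<close> is \<open>1 / v\<close>, which is the Laurent monomial \<open>w / (v w)\<close>, and likewise for \<open>w\<close>.
\<close>

lemma laurent_on_torus_coordinates:
  "laurent_on_torus fst" "laurent_on_torus snd"
  "laurent_on_torus (\<lambda>q. cnj (fst q))" "laurent_on_torus (\<lambda>q. cnj (snd q))"
proof -
  show "laurent_on_torus fst"
    by (rule laurent_on_torusI[of "[:0, 1:]" 0]) simp
  show "laurent_on_torus snd"
    by (rule laurent_on_torusI[of "[:[:0, 1:]:]" 0]) simp
  show "laurent_on_torus (\<lambda>q. cnj (fst q))"
    by (rule laurent_on_torusI[of "[:[:0, 1:]:]" 1]) (use torus_unit in \<open>simp add: mult_ac\<close>)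
  show "laurent_on_torus (\<lambda>q. cnj (snd q))"
    by (rule laurent_on_torusI[of "[:0, 1:]" 1]) (use torus_unit in \<open>simp add: mult_ac\<close>)
qed

lemma laurent_on_torus_add:
  assumes "laurent_on_torus f" "laurent_on_torus g"
  shows "laurent_on_torus (\<lambda>q. f q + g q)"
proof -
  obtain N Q where Q: "\<And>v w. (v, w) \<in> torus \<Longrightarrow> eval_vw Q v w = (v * w) ^ N * f (v, w)"
    using assms(1) unfolding laurent_on_torus_def by blast
  obtain N' Q' where Q': "\<And>v w. (v, w) \<in> torus \<Longrightarrow> eval_vw Q' v w = (v * w) ^ N' * g (v, w)"
    using assms(2) unfolding laurent_on_torus_def by blast
  show ?thesis
    by (rule laurent_on_torusI[of "monomial_vw ^ N' * Q + monomial_vw ^ N * Q'" "N + N'"])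
      (simp add: Q Q' power_add algebra_simps)
qed

lemma laurent_on_torus_mult:
  assumes "laurent_on_torus f" "laurent_on_torus g"
  shows "laurent_on_torus (\<lambda>q. f q * g q)"
proof -
  obtain N Q where Q: "\<And>v w. (v, w) \<in> torus \<Longrightarrow> eval_vw Q v w = (v * w) ^ N * f (v, w)"
    using assms(1) unfolding laurent_on_torus_def by blast
  obtain N' Q' where Q': "\<And>v w. (v, w) \<in> torus \<Longrightarrow> eval_vw Q' v w = (v * w) ^ N' * g (v, w)"
    using assms(2) unfolding laurent_on_torus_def by blast
  show ?thesis
    by (rule laurent_on_torusI[of "Q * Q'" "N + N'"])
      (simp add: Q Q' power_add algebra_simps)
qed

lemmas laurent_on_torus_intros = laurent_on_torus_const laurent_on_torus_coordinates
  laurent_on_torus_add laurent_on_torus_mult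

text \<open>
  A real-linear form on \<open>\<complex>\<^sup>2\<close> is a complex combination of the coordinates and their conjugates.
\<close>

lemma real_polynomial_function_laurent_on_torus:
  assumes "real_polynomial_function p"
  shows "laurent_on_torus (\<lambda>q. complex_of_real (p q))"
  using assms
proof induction
  case (linear f)
  interpret bounded_linear f by fact
  have decomp: "f (v, w) = Re v * f (1, 0) + Im v * f (\<i>, 0) + Re w * f (0, 1) + Im w * f (0, \<i>)" for v w
  proof -
    have "(v, w) = Re v *\<^sub>R (1, 0) + Im v *\<^sub>R (\<i>, 0) + Re w *\<^sub>R (0, 1) + Im w *\<^sub>R (0, \<i>)"
      by (simp add: complex_eq_iff)
    then have "f (v, w) = f (Re v *\<^sub>R (1, 0) + Im v *\<^sub>R (\<i>, 0) + Re w *\<^sub>R (0, 1) + Im w *\<^sub>R (0, \<i>))"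
      by (rule arg_cong)
    then show ?thesis
      by (simp only: add scaleR real_scaleR_def)
  qed
  have re_im: "complex_of_real (Re z) = 1 / 2 * z + 1 / 2 * cnj z"
    "complex_of_real (Im z) = - \<i> / 2 * z + \<i> / 2 * cnj z" for z
    by (simp_all add: complex_eq_iff)
  have f_eq: "complex_of_real (f q) =
      (1 / 2 * fst q + 1 / 2 * cnj (fst q)) * f (1, 0) + (- \<i> / 2 * fst q + \<i> / 2 * cnj (fst q)) * f (\<i>, 0) +
      (1 / 2 * snd q + 1 / 2 * cnj (snd q)) * f (0, 1) + (- \<i> / 2 * snd q + \<i> / 2 * cnj (snd q)) * f (0, \<i>)" for q
    unfolding re_im[symmetric]
    by (subst prod.collapse[symmetric], subst decomp) (simp only: of_real_add of_real_mult)
  show ?case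
    by (rule laurent_on_torus_cong[OF _ f_eq]) (intro laurent_on_torus_intros)
qed (auto intro: laurent_on_torus_intros)

lemma polynomial_function_laurent_on_torus:
  fixes g :: "complex \<times> complex \<Rightarrow> complex"
  assumes "polynomial_function g"
  shows "laurent_on_torus g"
proof -
  have "real_polynomial_function (Re \<circ> g)" "real_polynomial_function (Im \<circ> g)"
    using assms bounded_linear_Re bounded_linear_Im by (auto simp: polynomial_function_def)
  from this[THEN real_polynomial_function_laurent_on_torus]
  have "laurent_on_torus (\<lambda>q. complex_of_real ((Re \<circ> g) q) + \<i> * complex_of_real ((Im \<circ> g) q))"
    by (intro laurent_on_torus_intros)
  then show ?thesis
    by (rule laurent_on_torus_cong) (simp add: complex_eq)
qed

lemma compact_torus: "compact torus"
  unfolding torus_def by (intro compact_Times compact_sphere)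

lemma laurent_approximation_on_torus:
  assumes "continuous_on torus f" "0 < e"
  shows "\<exists>g. continuous_on torus g \<and> laurent_on_torus g \<and> (\<forall>q\<in>torus. norm (f q - g q) < e)"
proof -
  obtain g where "polynomial_function g" "\<forall>q\<in>torus. norm (f q - g q) < e"
    using Stone_Weierstrass_polynomial_function[OF compact_torus assms] by blast
  then show ?thesis
    using continuous_on_polymonial_function polynomial_function_laurent_on_torus by blast
qed

text \<open>
  All coefficients are brought to the common denominator \<open>(v w) ^ K\<close>, which becomes the leading
  coefficient with respect to \<open>u\<close> and vanishes nowhere on the torus.
\<close>

lemma polynomial_with_laurent_coefficients:
  fixes a :: "nat \<Rightarrow> complex \<times> complex \<Rightarrow> complex"
  assumes "\<And>j. j < m \<Longrightarrow> laurent_on_torus (a j)"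
  obtains f :: "complex poly poly poly" where "degree f = m"
    "zero_set_in_braid_space f = {(u, q). q \<in> torus \<and> poly (monic_poly m (\<lambda>j. a j q)) u = 0}"
proof -
  obtain N Q where Q: "\<And>j v w. \<lbrakk>j < m; (v, w) \<in> torus\<rbrakk> \<Longrightarrow> eval_vw (Q j) v w = (v * w) ^ N j * a j (v, w)"
    using assms unfolding laurent_on_torus_def by metis
  define K where "K = (\<Sum>j<m. N j)"
  define c where "c j = monomial_vw ^ (K - N j) * Q j" for j
  define f where "f = monom (monomial_vw ^ K) m + (\<Sum>j<m. monom (c j) j)"
  have c: "eval_vw (c j) v w = (v * w) ^ K * a j (v, w)" if "j < m" "(v, w) \<in> torus" for j v w
  proof -
    have "N j \<le> K"
      unfolding K_def using that(1) by (intro member_le_sum) auto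
    then show ?thesis
      by (simp add: c_def Q[OF that] mult.assoc[symmetric] power_add[symmetric])
  qed
  have coeff_f: "coeff f j = (if j < m then c j else if j = m then monomial_vw ^ K else 0)" for j
    by (auto simp: f_def coeff_sum)
  have "degree f = m"
    by (rule antisym) (auto intro!: degree_le le_degree simp: coeff_f)
  moreover have "eval_uvw f (u, v, w) = (v * w) ^ K * poly (monic_poly m (\<lambda>j. a j (v, w))) u"
    if vw: "(v, w) \<in> torus" for u v w
  proof -
    have "eval_uvw f (u, v, w) = eval_vw (poly f [:[:u:]:]) v w"
      by (simp add: eval_uvw_def eval_vw_def)
    also have "poly f [:[:u:]:] = monomial_vw ^ K * [:[:u:]:] ^ m + (\<Sum>j<m. c j * [:[:u:]:] ^ j)"
      by (simp add: f_def poly_sum poly_monom)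
    also have "eval_vw \<dots> v w = (v * w) ^ K * u ^ m + (\<Sum>j<m. (v * w) ^ K * a j (v, w) * u ^ j)"
      using c vw by (simp add: eval_vw_sum)
    also have "\<dots> = (v * w) ^ K * poly (monic_poly m (\<lambda>j. a j (v, w))) u"
      by (simp add: poly_monic_poly sum_distrib_left algebra_simps)
    finally show ?thesis .
  qed
  moreover have "v * w \<noteq> 0" if "(v, w) \<in> torus" for v w
    using that by (auto simp: torus_def)
  ultimately show thesis
    by (intro that[of f]) (auto simp: zero_set_in_braid_space_def braid_space_def)
qed


section \<open>Polynomial representatives of unbranched surface braids\<close>

text \<open>
  The zero set of \<open>f\<close> is as close to \<open>B\<close> as desired, and over each point of \<open>B\<close> the nearby point
  \<open>r x\<close> is a root of the polynomial \<open>P\<close> whose coefficients approximate those of the fibre polynomial \<open>R\<close>.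
\<close>

lemma polynomial_close_to_covering:
  assumes B: "B \<subseteq> braid_space" "compact B" and cov: "covering_space B snd torus"
    and fibres: "\<And>q. q \<in> torus \<Longrightarrow> finite {x \<in> B. snd x = q} \<and> card {x \<in> B. snd x = q} = m"
    and "0 < m" "0 < \<eta>"
    and sep: "\<And>x y. \<lbrakk>x \<in> B; y \<in> B; snd x = snd y; x \<noteq> y\<rbrakk> \<Longrightarrow> 2 * \<eta> \<le> norm (fst x - fst y)"
  obtains f :: "complex poly poly poly" and r :: "point \<Rightarrow> complex" where "degree f = m" "continuous_on B r"
    "\<forall>x\<in>B. norm (r x - fst x) \<le> \<eta>"
    "zero_set_in_braid_space f = (\<lambda>x. (r x, snd x)) ` B"
proof -
  let ?fib = "\<lambda>q. {x \<in> B. snd x = q}"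
  define R where "R q = (\<Prod>x\<in>?fib q. [:- fst x, 1:])" for q
  have B_torus: "snd x \<in> torus" if "x \<in> B" for x
    using B(1) that by (auto simp: braid_space_def)
  have R_monic: "lead_coeff (R q) = 1" for q
    unfolding R_def by (simp add: lead_coeff_prod)
  have R_degree: "degree (R q) = m" if "q \<in> torus" for q
    using fibres[OF that] unfolding R_def by (subst degree_prod_eq_sum_degree) auto
  have R_zero: "poly (R (snd x)) (fst x) = 0" if "x \<in> B" for x
    using that fibres[OF B_torus[OF that]] unfolding R_def poly_prod
    by (intro prod_zero bexI[of _ x]) auto
  have "bounded (fst ` B)"
    using B(2) by (intro compact_imp_bounded compact_continuous_image continuous_intros)
  then obtain M0 where "\<And>x. x \<in> B \<Longrightarrow> norm (fst x) \<le> M0"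
    by (auto simp: bounded_iff)
  then obtain M where M: "1 \<le> M" "\<And>x. x \<in> B \<Longrightarrow> norm (fst x) \<le> M"
    using that[of "max 1 M0"] by (meson max.cobounded1 max.coboundedI2)
  \<comment> \<open>Coefficients within \<open>e\<close> make \<open>P\<close> smaller than \<open>\<eta> ^ m\<close> at the roots of \<open>R\<close>, all of which lie
    in the disc of radius \<open>M\<close>.\<close>
  define e where "e = \<eta> ^ m / (2 * m * M ^ m)"
  have e: "0 < e" "m * e * M ^ m < \<eta> ^ m"
    using \<open>0 < m\<close> \<open>0 < \<eta>\<close> M(1) by (auto simp: e_def)
  have "\<exists>a. continuous_on torus a \<and> laurent_on_torus a \<and> (\<forall>q\<in>torus. norm (coeff (R q) j - a q) < e)" for j
    unfolding R_def using fibres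
    by (intro laurent_approximation_on_torus[OF _ e(1)] continuous_on_coeff_fibre_poly[OF cov] continuous_intros) auto
  then obtain a where a_cont: "\<And>j. continuous_on torus (a j)" and a_laurent: "\<And>j. laurent_on_torus (a j)"
    and a_close: "\<And>j q. q \<in> torus \<Longrightarrow> norm (coeff (R q) j - a j q) < e"
    by metis
  define P where "P q = monic_poly m (\<lambda>j. a j q)" for q
  have P_monic: "lead_coeff (P q) = 1" and P_degree: "degree (P q) = m" for q
    by (simp_all add: P_def coeff_monic_poly)
  have P_small: "norm (poly (P (snd x)) (fst x)) < \<eta> ^ m" if x: "x \<in> B" for x
  proof -
    let ?q = "snd x"
    have "norm (poly (P ?q) (fst x)) \<le> m * e * M ^ m"
    proof (rule norm_poly_at_root_of_close_poly[where Q = "R ?q"])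
      fix j assume "j < m"
      then show "norm (coeff (P ?q) j - coeff (R ?q) j) \<le> e"
        using a_close[OF B_torus[OF x], of j] by (simp add: P_def coeff_monic_poly norm_minus_commute)
    qed (rule P_degree R_degree[OF B_torus[OF x]] P_monic R_monic R_zero[OF x] M(2)[OF x] M(1))+
    then show ?thesis
      using e(2) by simp
  qed
  have "\<forall>q\<in>torus. \<exists>f. f ` fst ` ?fib q = {z. poly (P q) z = 0} \<and>
      (\<forall>u\<in>fst ` ?fib q. \<forall>z. poly (P q) z = 0 \<and> norm (z - u) \<le> \<eta> \<longleftrightarrow> z = f u)"
  proof
    fix q assume q: "q \<in> torus"
    have "inj_on fst (?fib q)"
      by (auto intro!: inj_onI simp: prod_eq_iff)
    then have X: "finite (fst ` ?fib q)" "card (fst ` ?fib q) = degree (P q)"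
      using fibres[OF q] by (auto simp: card_image P_degree)
    have small: "norm (poly (P q) u) < \<eta> ^ degree (P q)" if "u \<in> fst ` ?fib q" for u
      using that P_small by (auto simp: P_degree)
    have far: "2 * \<eta> \<le> norm (u - u')" if u: "u \<in> fst ` ?fib q" "u' \<in> fst ` ?fib q" "u \<noteq> u'" for u u'
    proof -
      obtain x y where "x \<in> ?fib q" "u = fst x" "y \<in> ?fib q" "u' = fst y"
        using u(1,2) by (elim imageE) simp
      then show ?thesis
        using sep[of x y] u(3) by auto
    qed
    show "\<exists>f. f ` fst ` ?fib q = {z. poly (P q) z = 0} \<and>
        (\<forall>u\<in>fst ` ?fib q. \<forall>z. poly (P q) z = 0 \<and> norm (z - u) \<le> \<eta> \<longleftrightarrow> z = f u)"
      by (rule roots_near_separated_almost_roots[OF P_monic X small \<open>0 < \<eta>\<close> far])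
  qed
  from bchoice[OF this] obtain \<rho> where \<rho>_spec: "\<forall>q\<in>torus. \<rho> q ` fst ` ?fib q = {z. poly (P q) z = 0} \<and>
      (\<forall>u\<in>fst ` ?fib q. \<forall>z. poly (P q) z = 0 \<and> norm (z - u) \<le> \<eta> \<longleftrightarrow> z = \<rho> q u)" ..
  have \<rho>_img: "\<rho> q ` fst ` ?fib q = {z. poly (P q) z = 0}" if "q \<in> torus" for q
    using bspec[OF \<rho>_spec that] by (rule conjunct1)
  have \<rho>: "poly (P q) z = 0 \<and> norm (z - u) \<le> \<eta> \<longleftrightarrow> z = \<rho> q u"
    if "q \<in> torus" "u \<in> fst ` ?fib q" for q u z
    using bspec[OF conjunct2[OF bspec[OF \<rho>_spec that(1)]] that(2)] by (rule spec)
  define r where "r x = \<rho> (snd x) (fst x)" for x :: point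
  have r: "poly (P (snd x)) z = 0 \<and> norm (z - fst x) \<le> \<eta> \<longleftrightarrow> z = r x" if "x \<in> B" for x z
    unfolding r_def using that by (intro \<rho> B_torus) auto
  have r_cont: "continuous_on B r"
  proof (rule continuous_on_unique_close_zero[OF B(2) _ continuous_on_fst[OF continuous_on_id]])
    have "continuous_on (B \<times> UNIV) (\<lambda>z. a j (snd (fst z)))" for j
      by (rule continuous_on_compose2[OF a_cont]) (use B_torus in \<open>auto intro!: continuous_intros\<close>)
    then show "continuous_on (B \<times> UNIV) (\<lambda>z. poly (P (snd (fst z))) (snd z))"
      unfolding P_def poly_monic_poly by (intro continuous_intros)
  qed (unfold fst_conv snd_conv, rule r)
  obtain f :: "complex poly poly poly" where "degree f = m"
    and f: "zero_set_in_braid_space f = {(u, q). q \<in> torus \<and> poly (P q) u = 0}"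
    by (rule polynomial_with_laurent_coefficients[of m a, OF a_laurent, folded P_def]) (rule that)
  have "(u, q) \<in> zero_set_in_braid_space f \<longleftrightarrow> (u, q) \<in> (\<lambda>x. (r x, snd x)) ` B" for u q
  proof -
    have "(u, q) \<in> zero_set_in_braid_space f \<longleftrightarrow> q \<in> torus \<and> u \<in> \<rho> q ` fst ` ?fib q"
      using \<rho>_img[of q] by (auto simp: f)
    also have "\<dots> \<longleftrightarrow> (u, q) \<in> (\<lambda>x. (r x, snd x)) ` B"
      unfolding image_image image_iff prod.inject r_def Bex_def mem_Collect_eq
      using B_torus by blast
    finally show ?thesis .
  qed
  then have f_zero: "zero_set_in_braid_space f = (\<lambda>x. (r x, snd x)) ` B"
    by (simp only: set_eq_iff split_paired_All) blast
  have r_near: "\<forall>x\<in>B. norm (r x - fst x) \<le> \<eta>"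
    using r by blast
  show thesis
    by (rule that[OF \<open>degree f = m\<close> r_cont r_near f_zero])
qed

theorem theorem1p4:
  fixes m :: nat and B :: "point set" and \<A> :: "point chart set"
  assumes "surface_braid m B \<A>" and "without_branch_points B"
  shows "\<exists>(f :: complex poly poly poly) \<A>'.
           surface_braid m (zero_set_in_braid_space f) \<A>' \<and>
           equivalent_surface_braids (zero_set_in_braid_space f) \<A>' B \<A> \<and>
           degree f = m"
proof -
  have cov: "covering_space B snd torus"
    using assms(2) by (simp add: without_branch_points_def)
  have B: "B \<subseteq> braid_space" "compact B"
    and fibres: "\<And>q. q \<in> torus \<Longrightarrow> finite {x \<in> B. snd x = q} \<and> card {x \<in> B. snd x = q} = m"
    using assms(1) unfolding unbranched_surface_braid_iff[OF assms(2)] by blast+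
  have "0 < m"
  proof (rule ccontr)
    assume "\<not> 0 < m"
    then have "m = 0" by simp
    have one: "(1, 1) \<in> torus"
      by (simp add: torus_def)
    then have "(1, 1) \<in> snd ` B"
      using covering_space_imp_surjective[OF cov] by simp
    then obtain x where "x \<in> B" "snd x = (1, 1)"
      by (elim imageE) simp
    moreover have "{x \<in> B. snd x = (1, 1)} = {}"
      using fibres[OF one] unfolding \<open>m = 0\<close> by (elim conjE) (simp only: card_0_eq)
    ultimately show False
      by blast
  qed
  obtain \<epsilon> where "0 < \<epsilon>" and \<epsilon>: "\<And>x y. \<lbrakk>x \<in> B; y \<in> B; snd x = snd y; dist x y < \<epsilon>\<rbrakk> \<Longrightarrow> x = y"
    using covering_space_fibre_separation[OF cov B(2)] by blast
  have sep: "\<epsilon> \<le> norm (fst x - fst y)" if "x \<in> B" "y \<in> B" "snd x = snd y" "x \<noteq> y" for x y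
    using \<epsilon>[OF that(1-3)] that(3,4) by (auto simp: dist_prod_def dist_norm not_less[symmetric])
  \<comment> \<open>A displacement by at most \<open>\<epsilon> / 4\<close> leaves the separation \<open>\<epsilon> / 2\<close>, the radius of the bumps; the
    factor \<open>m\<close> in the denominator pays for the \<open>m\<close> summands of the vector field.\<close>
  define \<eta> where "\<eta> = \<epsilon> / (4 * m)"
  have \<eta>: "0 < \<eta>" "4 * (m * \<eta>) = \<epsilon>"
    using \<open>0 < m\<close> \<open>0 < \<epsilon>\<close> by (auto simp: \<eta>_def)
  have "1 * \<eta> \<le> m * \<eta>"
    using \<open>0 < m\<close> \<eta>(1) by (intro mult_right_mono) auto
  then have \<eta>_le: "4 * \<eta> \<le> \<epsilon>"
    using \<eta>(2) by simp
  have sep': "2 * \<eta> \<le> norm (fst x - fst y)" if "x \<in> B" "y \<in> B" "snd x = snd y" "x \<noteq> y" for x y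
    using sep[OF that] \<eta>(1) \<eta>_le by linarith
  obtain f :: "complex poly poly poly" and r :: "point \<Rightarrow> complex"
    where f: "degree f = m" "zero_set_in_braid_space f = (\<lambda>x. (r x, snd x)) ` B"
      and r: "continuous_on B r" "\<forall>x\<in>B. norm (r x - fst x) \<le> \<eta>"
    by (rule polynomial_close_to_covering[OF B cov fibres \<open>0 < m\<close> \<eta>(1) sep']) (assumption | rule that)+
  have "\<epsilon> / 2 \<le> norm (r x - r y)" if xy: "x \<in> B" "y \<in> B" "snd x = snd y" "x \<noteq> y" for x y
  proof -
    have "fst x - fst y = (r x - r y) - (r x - fst x) + (r y - fst y)"
      by simp
    also have "norm \<dots> \<le> norm (r x - r y) + norm (r x - fst x) + norm (r y - fst y)"
      by (intro order_trans[OF norm_triangle_ineq] add_mono norm_triangle_ineq4 order.refl)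
    finally show ?thesis
      using sep[OF xy] bspec[OF r(2) xy(1)] bspec[OF r(2) xy(2)] \<eta>_le by linarith
  qed
  then have "\<exists>h. fibre_preserving_isotopy h \<and> h 1 ` (\<lambda>x. (r x, snd x)) ` B = B \<and>
      (\<forall>x. snd (h 1 x) = snd x)"
    using \<open>0 < \<epsilon>\<close> \<eta>(2) r(2)
    by (intro isotopy_to_close_surface[OF B(1) cov fibres r(1), where \<delta> = "\<epsilon> / 2" and \<eta> = \<eta>])
      (auto simp: norm_minus_commute)
  then obtain h where h: "fibre_preserving_isotopy h \<and> h 1 ` (\<lambda>x. (r x, snd x)) ` B = B \<and>
      (\<forall>x. snd (h 1 x) = snd x)" ..
  have "\<exists>\<A>'. surface_braid m (zero_set_in_braid_space f) \<A>' \<and>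
      equivalent_surface_braids (zero_set_in_braid_space f) \<A>' B \<A>"
  proof (rule surface_braid_via_isotopy[OF assms])
    show "zero_set_in_braid_space f \<subseteq> braid_space"
      by (simp add: zero_set_in_braid_space_def)
    show "h 1 ` zero_set_in_braid_space f = B"
      using h unfolding f(2) by (elim conjE)
  qed (use h in blast)+
  then show ?thesis
    using f(1) by blast
qed

end
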